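(* Let $G$ be a group, $M$ a right $\mathbb Z[G]$-module, $\varphi:G\to Z(G)$ a group homomorphism into the center of $G$, $X=M\times G$ the $G$-Alexander biquandle of $(M,\varphi)$, and $A$ an abelian group. Let $n\ge 1$. For any group $n$-cocycle $f:C_n^{\rm gp}(M;\mathbb Z)_G\to A$, the map $$\Phi_f:=f\circ\psi_n\circ\gamma_n:\ C_n^{\rm BR}(X;\mathbb Z)\to A$$ is a birack $n$-cocycle of the $G$-Alexander biquandle $X$ (with trivial $X$-set).
   Context: **$G$-Alexander biquandle.** $X=M\times G$ with the operations $(m,g)\,\underline{*}\,(n,h)=(mh+n(\varphi(h)-h),\,h^{-1}gh)$ and $(m,g)\,\overline{*}\,(n,h)=(m\varphi(h),\,g)$. **Birack complex (trivial $X$-set).** $C_n^{\rm BR}(X;\mathbb Z)$ is the free abelian group on $X^n$ for $n\ge1$, and $0$ otherwise. For $n\ge2$, $$\partial_n^{\rm BR}(x_1,\dots,x_n)=\sum_{i=1}^n(-1)^{i-1}\{(x_1,\dots,x_{i-1},x_{i+1},\dots,x_n)-(x_1\underline{*}x_i,\dots,x_{i-1}\underline{*}x_i,x_{i+1}\overline{*}x_i,\dots,x_n\overline{*}x_i)\},$$ and $\partial^{\rm BR}_n=0$ for $n\le1$. A birack $n$-cocycle with values in $A$ is a homomorphism $\Phi:C_n^{\rm BR}(X;\mathbb Z)\to A$ with $\Phi\circ\partial_{n+1}^{\rm BR}=0$. **Group complex.** $C_n^{\rm gp}(M;\mathbb Z)$ is the free abelian group on $M^n$ for $n\ge1$, and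 $0$ otherwise. For $n\ge 2$, $$\partial_n^{\rm gp}(m_1,\dots,m_n)=(m_2,\dots,m_n)+\sum_{i=1}^{n-1}(-1)^i(m_1,\dots,m_i+m_{i+1},\dots,m_n)+(-1)^n(m_1,\dots,m_{n-1}),$$ and $\partial_n^{\rm gp}=0$ for $n\le1$. $C_n^{\rm gp}(M;\mathbb Z)_G$ is the quotient (coinvariants) of $C_n^{\rm gp}(M;\mathbb Z)$ by all $(m_1g,\dots,m_ng)-(m_1,\dots,m_n)$, $g\in G$, with the induced boundary map. A group $n$-cocycle is a homomorphism $f:C_n^{\rm gp}(M;\mathbb Z)_G\to A$ with $f\circ\partial_{n+1}^{\rm gp}=0$. **The maps.** $C_n^{\rm BR_U}(X;\mathbb Z)$ is, for $n\ge1$, the free abelian group on $G^n\times M^n$, with generators written $(g_1,\dots,g_n;m_1,\dots,m_n)$. The homomorphism $\gamma_n:C_n^{\rm BR}(X;\mathbb Z)\to C_n^{\rm BR_U}(X;\mathbb Z)$ is $$\gamma_n((m_1,g_1),\dots,(m_n,g_n))=(g_1,\dots,g_n;\,m_1-m_2,\,m_2-m_3,\dots,m_{n-1}-m_n,\,m_n).$$ The homomorphism $\psi_n:C_n^{\rm BR_U}(X;\mathbb Z)\to C_n^{\rm gp}(M;\mathbb Z)_G$ is $$\psi_n(g_1,\dots,g_n;m_1,\dots,m_n)=\sum_{k}(-1)^{k_1+\cdots+k_n}(m_1\bm g_{k,1},\dots,m_n\bm g_{k,n}),$$ where $k=(k_1,\dots,k_n)$ runs over $\{0,1\}^n$ with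 $k_1=0$, and $\bm g_{k,i}=\varphi(g_1^{k_1}\cdots g_i^{k_i})\,g_{i+1}^{k_{i+1}}\cdots g_n^{k_n}\in G$. *)

theory Defs
  imports "HOL-Algebra.Free_Abelian_Groups" "HOL-Algebra.Module"
begin

section \<open>Right modules over the integral group ring\<close>

text \<open>
  The group ring consists of the finitely supported functions \<open>carrier G \<rightarrow> \<int>\<close>, its product being
  the bilinear extension of the product of \<open>G\<close>; the group element \<open>g\<close> is \<open>frag_of g\<close>.
\<close>

definition group_ring :: "('g, 'b) monoid_scheme \<Rightarrow> ('g \<Rightarrow>\<^sub>0 int) ring" where
  "group_ring G =
     \<lparr>carrier = {a. Poly_Mapping.keys a \<subseteq> carrier G},
      monoid.mult = (\<lambda>a b. frag_extend (\<lambda>g. frag_extend (\<lambda>h. frag_of (g \<otimes>\<^bsub>G\<^esub> h)) b) a),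
      monoid.one = frag_of \<one>\<^bsub>G\<^esub>,
      ring.zero = 0,
      ring.add = (+)\<rparr>"

lemma group_ring_mult_closed:
  assumes "group G" "a \<in> carrier (group_ring G)" "b \<in> carrier (group_ring G)"
  shows "a \<otimes>\<^bsub>group_ring G\<^esub> b \<in> carrier (group_ring G)"
proof -
  interpret group G by fact
  have "Poly_Mapping.keys (frag_extend (\<lambda>h. frag_of (g \<otimes>\<^bsub>G\<^esub> h)) b) \<subseteq> carrier G"
    if "g \<in> Poly_Mapping.keys a" for g
    using assms that
    by (intro order.trans[OF keys_frag_extend]) (auto simp: group_ring_def subset_iff)
  then show ?thesis
    using keys_frag_extend[of "\<lambda>g. frag_extend (\<lambda>h. frag_of (g \<otimes>\<^bsub>G\<^esub> h)) b" a]
    by (fastforce simp: group_ring_def)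
qed

lemma frag_extend_add_fun:
  "frag_extend (\<lambda>x. f x + g x) a = frag_extend f a + frag_extend g a"
  by (simp add: frag_extend_def frag_cmul_distrib2 sum.distrib)

lemma frag_extend_diff_fun:
  "frag_extend (\<lambda>x. f x - g x) a = frag_extend f a - frag_extend g a"
  using frag_extend_add_fun[of "\<lambda>x. f x - g x" g a] by simp

lemma ring_group_ring:
  assumes "group G"
  shows "ring (group_ring G)"
proof -
  interpret group G by fact
  let ?m = "\<lambda>a b. frag_extend (\<lambda>g. frag_extend (\<lambda>h. frag_of (g \<otimes>\<^bsub>G\<^esub> h)) b) a"
  have m0: "?m 0 b = 0" "?m b 0 = 0" for b
    by (simp_all add: frag_extend_eq_0)
  have ml: "?m (a - b) c = ?m a c - ?m b c" "?m (a + b) c = ?m a c + ?m b c" for a b c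
    by (simp_all add: frag_extend_diff frag_extend_add)
  have mr: "?m c (a - b) = ?m c a - ?m c b" "?m c (a + b) = ?m c a + ?m c b" for a b c
    by (simp_all add: frag_extend_diff frag_extend_add frag_extend_diff_fun frag_extend_add_fun)
  have ag: "abelian_group (group_ring G)"
  proof (rule abelian_groupI)
    fix x assume "x \<in> carrier (group_ring G)"
    then show "\<exists>y\<in>carrier (group_ring G). y \<oplus>\<^bsub>group_ring G\<^esub> x = \<zero>\<^bsub>group_ring G\<^esub>"
      by (intro bexI[of _ "- x"]) (auto simp: group_ring_def)
  next
    fix x y assume "x \<in> carrier (group_ring G)" "y \<in> carrier (group_ring G)"
    then show "x \<oplus>\<^bsub>group_ring G\<^esub> y \<in> carrier (group_ring G)"
      using Poly_Mapping.keys_add[of x y] by (auto simp: group_ring_def)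
  qed (auto simp: group_ring_def algebra_simps)
  have assoc: "?m (?m a b) c = ?m a (?m b c)"
    if a: "Poly_Mapping.keys a \<subseteq> carrier G" and b: "Poly_Mapping.keys b \<subseteq> carrier G"
      and c: "Poly_Mapping.keys c \<subseteq> carrier G" for a b c
    using a
  proof (induction a rule: frag_induction)
    case (one x)
    show ?case using b
    proof (induction b rule: frag_induction)
      case (one y)
      show ?case using c
        by (induction c rule: frag_induction)
          (use one \<open>x \<in> carrier G\<close> in \<open>simp_all add: frag_extend_diff m_assoc\<close>)
    next
      case (diff a b) then show ?case by (simp only: mr ml)
    qed (simp add: m0)
  next
    case (diff a b) then show ?case by (simp only: ml)
  qed (simp add: m0)
  have one_l: "?m (frag_of \<one>\<^bsub>G\<^esub>) a = a" if "Poly_Mapping.keys a \<subseteq> carrier G" for a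
    using that
    by (induction a rule: frag_induction) (simp_all add: frag_extend_diff)
  have one_r: "?m a (frag_of \<one>\<^bsub>G\<^esub>) = a" if "Poly_Mapping.keys a \<subseteq> carrier G" for a
    using that
    by (induction a rule: frag_induction) (simp_all add: frag_extend_diff)
  have mon: "Group.monoid (group_ring G)"
  proof (rule monoidI)
    fix x y assume "x \<in> carrier (group_ring G)" "y \<in> carrier (group_ring G)"
    then show "x \<otimes>\<^bsub>group_ring G\<^esub> y \<in> carrier (group_ring G)"
      by (rule group_ring_mult_closed[OF assms])
  qed (simp_all add: group_ring_def assoc one_l[simplified] one_r[simplified])
  show ?thesis
    by (rule ringI[OF ag mon]) (simp_all add: group_ring_def ml mr)
qed

locale right_module = R?: ring R + M?: abelian_group M for R (structure) and M (structure) +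
  fixes act :: "'m \<Rightarrow> 'r \<Rightarrow> 'm"
  assumes act_closed: "\<lbrakk>x \<in> carrier M; a \<in> carrier R\<rbrakk> \<Longrightarrow> act x a \<in> carrier M"
    and act_add_left: "\<lbrakk>x \<in> carrier M; y \<in> carrier M; a \<in> carrier R\<rbrakk> \<Longrightarrow>
      act (x \<oplus>\<^bsub>M\<^esub> y) a = act x a \<oplus>\<^bsub>M\<^esub> act y a"
    and act_add_right: "\<lbrakk>x \<in> carrier M; a \<in> carrier R; b \<in> carrier R\<rbrakk> \<Longrightarrow>
      act x (a \<oplus>\<^bsub>R\<^esub> b) = act x a \<oplus>\<^bsub>M\<^esub> act x b"
    and act_mult: "\<lbrakk>x \<in> carrier M; a \<in> carrier R; b \<in> carrier R\<rbrakk> \<Longrightarrow>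
      act x (a \<otimes>\<^bsub>R\<^esub> b) = act (act x a) b"
    and act_one: "x \<in> carrier M \<Longrightarrow> act x \<one>\<^bsub>R\<^esub> = x"

definition center :: "('g, 'b) monoid_scheme \<Rightarrow> 'g set" where
  "center G = {z \<in> carrier G. \<forall>g \<in> carrier G. z \<otimes>\<^bsub>G\<^esub> g = g \<otimes>\<^bsub>G\<^esub> z}"


section \<open>The birack complex with trivial coefficient set\<close>

definition tuples :: "nat \<Rightarrow> 'x set \<Rightarrow> 'x list set" where
  "tuples n X = {xs. length xs = n \<and> set xs \<subseteq> X}"

definition birack_chains :: "'x set \<Rightarrow> nat \<Rightarrow> ('x list \<Rightarrow>\<^sub>0 int) monoid" where
  "birack_chains X n = free_Abelian_group (if n \<ge> 1 then tuples n X else {})"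

text \<open>
  List positions count from 0, so the sign attached to position \<open>i\<close> is \<open>(-1) ^ i\<close>.
\<close>

definition birack_boundary ::
    "('x \<Rightarrow> 'x \<Rightarrow> 'x) \<Rightarrow> ('x \<Rightarrow> 'x \<Rightarrow> 'x) \<Rightarrow> nat \<Rightarrow> ('x list \<Rightarrow>\<^sub>0 int) \<Rightarrow> ('x list \<Rightarrow>\<^sub>0 int)" where
  "birack_boundary ustar ostar n =
     (if n \<ge> 2 then
        frag_extend (\<lambda>xs. \<Sum>i<n. frag_cmul ((-1) ^ i)
          (frag_of (take i xs @ drop (Suc i) xs)
           - frag_of (map (\<lambda>x. ustar x (xs ! i)) (take i xs)
                      @ map (\<lambda>x. ostar x (xs ! i)) (drop (Suc i) xs))))
      else (\<lambda>c. 0))"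

definition birack_cocycle ::
    "'x set \<Rightarrow> ('x \<Rightarrow> 'x \<Rightarrow> 'x) \<Rightarrow> ('x \<Rightarrow> 'x \<Rightarrow> 'x) \<Rightarrow> ('a, 'c) monoid_scheme \<Rightarrow> nat
      \<Rightarrow> (('x list \<Rightarrow>\<^sub>0 int) \<Rightarrow> 'a) \<Rightarrow> bool" where
  "birack_cocycle X ustar ostar A n \<Phi> \<longleftrightarrow>
     \<Phi> \<in> hom (birack_chains X n) A \<and>
     (\<forall>c \<in> carrier (birack_chains X (n + 1)). \<Phi> (birack_boundary ustar ostar (n + 1) c) = \<one>\<^bsub>A\<^esub>)"


section \<open>The Alexander biquandle\<close>

definition alex_carrier :: "('g, 'b) monoid_scheme \<Rightarrow> ('m, 'c) ring_scheme \<Rightarrow> ('m \<times> 'g) set" where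
  "alex_carrier G M = carrier M \<times> carrier G"

definition alex_under ::
    "('g, 'b) monoid_scheme \<Rightarrow> ('m, 'c) ring_scheme \<Rightarrow> ('m \<Rightarrow> ('g \<Rightarrow>\<^sub>0 int) \<Rightarrow> 'm) \<Rightarrow> ('g \<Rightarrow> 'g)
      \<Rightarrow> 'm \<times> 'g \<Rightarrow> 'm \<times> 'g \<Rightarrow> 'm \<times> 'g" where
  "alex_under G M act \<phi> = (\<lambda>(m, g) (n, h).
     (act m (frag_of h) \<oplus>\<^bsub>M\<^esub> act n (frag_of (\<phi> h) \<ominus>\<^bsub>group_ring G\<^esub> frag_of h),
      inv\<^bsub>G\<^esub> h \<otimes>\<^bsub>G\<^esub> g \<otimes>\<^bsub>G\<^esub> h))"

definition alex_over ::
    "('m \<Rightarrow> ('g \<Rightarrow>\<^sub>0 int) \<Rightarrow> 'm) \<Rightarrow> ('g \<Rightarrow> 'g) \<Rightarrow> 'm \<times> 'g \<Rightarrow> 'm \<times> 'g \<Rightarrow> 'm \<times> 'g" where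
  "alex_over act \<phi> = (\<lambda>(m, g) (n, h). (act m (frag_of (\<phi> h)), g))"


section \<open>The group complex of \<open>M\<close> and its coinvariants\<close>

definition gp_chains :: "('m, 'c) ring_scheme \<Rightarrow> nat \<Rightarrow> ('m list \<Rightarrow>\<^sub>0 int) monoid" where
  "gp_chains M n = free_Abelian_group (if n \<ge> 1 then tuples n (carrier M) else {})"

definition gp_boundary ::
    "('m, 'c) ring_scheme \<Rightarrow> nat \<Rightarrow> ('m list \<Rightarrow>\<^sub>0 int) \<Rightarrow> ('m list \<Rightarrow>\<^sub>0 int)" where
  "gp_boundary M n =
     (if n \<ge> 2 then
        frag_extend (\<lambda>ms. frag_of (tl ms)
          + (\<Sum>i = 1..n - 1. frag_cmul ((-1) ^ i)
               (frag_of (take (i - 1) ms @ [ms ! (i - 1) \<oplus>\<^bsub>M\<^esub> ms ! i] @ drop (i + 1) ms)))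
          + frag_cmul ((-1) ^ n) (frag_of (butlast ms)))
      else (\<lambda>c. 0))"

definition coinv_relations ::
    "('g, 'b) monoid_scheme \<Rightarrow> ('m, 'c) ring_scheme \<Rightarrow> ('m \<Rightarrow> ('g \<Rightarrow>\<^sub>0 int) \<Rightarrow> 'm) \<Rightarrow> nat
      \<Rightarrow> ('m list \<Rightarrow>\<^sub>0 int) set" where
  "coinv_relations G M act n = generate (gp_chains M n)
     {frag_of (map (\<lambda>m. act m (frag_of g)) ms) - frag_of ms | g ms.
        g \<in> carrier G \<and> n \<ge> 1 \<and> ms \<in> tuples n (carrier M)}"

definition coinv_chains ::
    "('g, 'b) monoid_scheme \<Rightarrow> ('m, 'c) ring_scheme \<Rightarrow> ('m \<Rightarrow> ('g \<Rightarrow>\<^sub>0 int) \<Rightarrow> 'm) \<Rightarrow> nat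
      \<Rightarrow> ('m list \<Rightarrow>\<^sub>0 int) set monoid" where
  "coinv_chains G M act n = gp_chains M n Mod coinv_relations G M act n"

definition coinv_class ::
    "('g, 'b) monoid_scheme \<Rightarrow> ('m, 'c) ring_scheme \<Rightarrow> ('m \<Rightarrow> ('g \<Rightarrow>\<^sub>0 int) \<Rightarrow> 'm) \<Rightarrow> nat
      \<Rightarrow> ('m list \<Rightarrow>\<^sub>0 int) \<Rightarrow> ('m list \<Rightarrow>\<^sub>0 int) set" where
  "coinv_class G M act n c = coinv_relations G M act n #>\<^bsub>gp_chains M n\<^esub> c"

text \<open>
  The induced boundary map sends the class of \<open>c\<close> to the class of \<open>gp_boundary M n c\<close>, see
  \<open>coinv_boundary_class\<close> below.
\<close>

definition coinv_boundary ::
    "('g, 'b) monoid_scheme \<Rightarrow> ('m, 'c) ring_scheme \<Rightarrow> ('m \<Rightarrow> ('g \<Rightarrow>\<^sub>0 int) \<Rightarrow> 'm) \<Rightarrow> nat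
      \<Rightarrow> ('m list \<Rightarrow>\<^sub>0 int) set \<Rightarrow> ('m list \<Rightarrow>\<^sub>0 int) set" where
  "coinv_boundary G M act n U =
     the_elem ((\<lambda>c. coinv_class G M act (n - 1) (gp_boundary M n c)) ` U)"

lemma take_nth_drop_map:
  assumes "i \<ge> 1" "i < length ms"
  shows "take (i - 1) (map h ms) @ [map h ms ! (i - 1) \<oplus>\<^bsub>M\<^esub> map h ms ! i] @ drop (i + 1) (map h ms)
    = map h (take (i - 1) ms) @ [h (ms ! (i - 1)) \<oplus>\<^bsub>M\<^esub> h (ms ! i)] @ map h (drop (i + 1) ms)"
  using assms by (simp add: take_map drop_map)

lemma gp_boundary_diff: "gp_boundary M n (a - b) = gp_boundary M n a - gp_boundary M n b"
  and gp_boundary_0: "gp_boundary M n 0 = 0"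
  by (simp_all add: gp_boundary_def frag_extend_diff)

lemma tuples_face:
  assumes "ms \<in> tuples n (carrier M)" "n \<ge> 2" "abelian_group M"
  shows "tl ms \<in> tuples (n - 1) (carrier M)" "butlast ms \<in> tuples (n - 1) (carrier M)"
    "i \<in> {1..n - 1} \<Longrightarrow>
      take (i - 1) ms @ [ms ! (i - 1) \<oplus>\<^bsub>M\<^esub> ms ! i] @ drop (i + 1) ms \<in> tuples (n - 1) (carrier M)"
proof -
  interpret abelian_group M by fact
  show "tl ms \<in> tuples (n - 1) (carrier M)" "butlast ms \<in> tuples (n - 1) (carrier M)"
    using assms by (auto simp: tuples_def dest: in_set_butlastD list.set_sel(2)[rotated])
  assume i: "i \<in> {1..n - 1}"
  have "ms ! (i - 1) \<in> carrier M" "ms ! i \<in> carrier M"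
    using i assms nth_mem[of "i - 1" ms] nth_mem[of i ms] by (auto simp: tuples_def)
  then show "take (i - 1) ms @ [ms ! (i - 1) \<oplus>\<^bsub>M\<^esub> ms ! i] @ drop (i + 1) ms
      \<in> tuples (n - 1) (carrier M)"
    using i assms set_take_subset[of "i - 1" ms] set_drop_subset[of "Suc i" ms]
    by (auto simp: tuples_def)
qed

lemma gp_boundary_closed_under:
  assumes c: "Poly_Mapping.keys c \<subseteq> tuples n (carrier M)" and n: "n \<ge> 2" and M: "abelian_group M"
    and 0: "P 0" and diff: "\<And>a b. P a \<Longrightarrow> P b \<Longrightarrow> P (a - b)"
    and gen: "\<And>ms. ms \<in> tuples (n - 1) (carrier M) \<Longrightarrow> P (frag_of ms)"
  shows "P (gp_boundary M n c)"
proof -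
  have add: "P (a + b)" if "P a" "P b" for a b
    using diff[OF that(1) diff[OF 0 that(2)]] by simp
  have cmul: "P (frag_cmul k a)" if "P a" for k a
    by (rule frag_closure_minus_cmul) (use that 0 diff in auto)
  have sum: "P (sum g I)" if "\<And>i. i \<in> I \<Longrightarrow> P (g i)" for g and I :: "nat set"
    using that by (induction I rule: infinite_finite_induct) (auto intro: 0 add)
  show ?thesis using c
  proof (induction c rule: frag_induction)
    case (one ms)
    then show ?case using n
      by (simp only: gp_boundary_def if_True frag_extend_of)
        (intro add cmul sum gen tuples_face[OF one n M]; assumption)
  qed (auto simp: gp_boundary_diff gp_boundary_0 0 diff)
qed

lemma coinv_boundary_class:
  assumes "group G" and "right_module (group_ring G) M act" and c: "c \<in> carrier (gp_chains M n)"
  shows "coinv_boundary G M act n (coinv_class G M act n c) =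
    coinv_class G M act (n - 1) (gp_boundary M n c)"
proof -
  interpret G: group G by fact
  interpret RM: right_module "group_ring G" M act by fact
  let ?C = "gp_chains M" and ?K = "coinv_relations G M act"
  have grp: "group (?C m)" for m
    by (simp add: gp_chains_def)
  have sub: "subgroup (?K m) (?C m)" for m
    unfolding coinv_relations_def
    by (rule group.generate_is_subgroup[OF grp])
      (auto simp: gp_chains_def tuples_def group_ring_def subset_iff intro!: RM.act_closed
        dest!: subsetD[OF keys_diff] split: if_splits)
  have K0: "0 \<in> ?K m" for m
    using subgroup.one_closed[OF sub[of m]] by (simp add: gp_chains_def)
  have Kinv: "- a \<in> ?K m" if "a \<in> ?K m" for a m
    using subgroup.m_inv_closed[OF sub that] subgroup.mem_carrier[OF sub that]
    by (simp add: gp_chains_def)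
  have Kadd: "a + b \<in> ?K m" if "a \<in> ?K m" "b \<in> ?K m" for a b m
    using subgroup.m_closed[OF sub that] by (simp add: gp_chains_def)
  have Kdiff: "a - b \<in> ?K m" if "a \<in> ?K m" "b \<in> ?K m" for a b m
    using Kadd[OF that(1) Kinv[OF that(2)]] by simp
  have Kcmul: "frag_cmul k a \<in> ?K m" if "a \<in> ?K m" for k a m
    by (rule frag_closure_minus_cmul) (use that K0 Kdiff in auto)
  have Ksum: "sum h I \<in> ?K m" if "\<And>i. i \<in> I \<Longrightarrow> h i \<in> ?K m" for h m and I :: "nat set"
    using that by (induction I rule: infinite_finite_induct) (auto intro: K0 Kadd)
  have closed: "gp_boundary M n d \<in> carrier (?C (n - 1))" if "d \<in> carrier (?C n)" for d
  proof (cases "n \<ge> 2")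
    case True
    have "Poly_Mapping.keys d \<subseteq> tuples n (carrier M)"
      using True that by (simp add: gp_chains_def)
    then have "Poly_Mapping.keys (gp_boundary M n d) \<subseteq> tuples (n - 1) (carrier M)"
      by (rule gp_boundary_closed_under[OF _ True RM.M.abelian_group_axioms])
        (use keys_diff in \<open>fastforce+\<close>)
    moreover have "n - 1 \<ge> 1" using True by simp
    ultimately show ?thesis by (simp add: gp_chains_def)
  qed (simp add: gp_boundary_def gp_chains_def)
  have rel: "frag_of (map (\<lambda>m. act m (frag_of g)) ms) - frag_of ms \<in> ?K m"
    if "g \<in> carrier G" "m \<ge> 1" "ms \<in> tuples m (carrier M)" for g ms m
    unfolding coinv_relations_def by (rule generate.incl) (use that in blast)
  have bK: "gp_boundary M n k \<in> ?K (n - 1)" if "k \<in> ?K n" for k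
  proof (cases "n \<ge> 2")
    case n: True
    show ?thesis
      using that unfolding coinv_relations_def[of G M act n]
    proof (induction k rule: generate.induct)
      case one show ?case by (simp add: gp_chains_def gp_boundary_0 K0)
    next
      have *: "gp_boundary M n h \<in> ?K (n - 1)" if "h \<in> {frag_of (map (\<lambda>m. act m (frag_of g)) ms) - frag_of ms | g ms.
        g \<in> carrier G \<and> n \<ge> 1 \<and> ms \<in> tuples n (carrier M)}" (is "h \<in> ?S") for h
      proof -
        obtain g ms where g: "g \<in> carrier G" and ms: "ms \<in> tuples n (carrier M)"
          and h: "h = frag_of (map (\<lambda>m. act m (frag_of g)) ms) - frag_of ms"
          using \<open>h \<in> ?S\<close> by blast
        let ?a = "\<lambda>m. act m (frag_of g)"
        let ?f = "\<lambda>ms i. take (i - 1) ms @ [ms ! (i - 1) \<oplus>\<^bsub>M\<^esub> ms ! i] @ drop (i + 1) ms"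
        have len: "length ms = n" using ms by (simp add: tuples_def)
        have f: "?f (map ?a ms) i = map ?a (?f ms i)" if "i \<in> {1..n - 1}" for i
        proof -
          have "ms ! (i - 1) \<in> carrier M" "ms ! i \<in> carrier M"
            using that ms n nth_mem[of "i - 1" ms] nth_mem[of i ms] by (auto simp: tuples_def)
          then show ?thesis
            using that len n g
            by (subst take_nth_drop_map) (auto simp: RM.act_add_left group_ring_def)
        qed
        have "gp_boundary M n h =
            (frag_of (map ?a (tl ms)) - frag_of (tl ms))
            + (\<Sum>i = 1..n - 1. frag_cmul ((-1) ^ i) (frag_of (map ?a (?f ms i)) - frag_of (?f ms i)))
            + frag_cmul ((-1) ^ n) (frag_of (map ?a (butlast ms)) - frag_of (butlast ms))"
        proof -
          have s: "(\<Sum>i = 1..n - 1. frag_cmul ((-1) ^ i) (frag_of (?f (map ?a ms) i)))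
             = (\<Sum>i = 1..n - 1. frag_cmul ((-1) ^ i) (frag_of (map ?a (?f ms i))))"
            by (rule sum.cong[OF refl]) (simp only: f)
          have cd: "frag_cmul k (a - b) = frag_cmul k a - frag_cmul k b" for k and a b :: "'c list \<Rightarrow>\<^sub>0 int"
            using frag_cmul_distrib2[of k "a - b" b] by simp
          have "gp_boundary M n h =
            (frag_of (tl (map ?a ms))
             + (\<Sum>i = 1..n - 1. frag_cmul ((-1) ^ i) (frag_of (?f (map ?a ms) i)))
             + frag_cmul ((-1) ^ n) (frag_of (butlast (map ?a ms))))
            - (frag_of (tl ms)
             + (\<Sum>i = 1..n - 1. frag_cmul ((-1) ^ i) (frag_of (?f ms i)))
             + frag_cmul ((-1) ^ n) (frag_of (butlast ms)))"
            unfolding h gp_boundary_diff using n by (simp only: gp_boundary_def if_True frag_extend_of)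
          then show ?thesis
            unfolding s cd sum_subtractf map_tl[symmetric] map_butlast[symmetric]
            by (simp add: algebra_simps)
        qed
        also have "\<dots> \<in> ?K (n - 1)"
          by (intro Kadd Kcmul Ksum rel g tuples_face[OF ms n RM.M.abelian_group_axioms])
            (use n in auto)
        finally show ?thesis .
      qed
      { case (incl h) then show ?case by (rule *) }
      case (inv h)
      have "h \<in> carrier (?C n)"
        using generate.incl[OF inv] subgroup.mem_carrier[OF sub[of n]]
        unfolding coinv_relations_def by blast
      moreover have "gp_boundary M n (- h) = - gp_boundary M n h"
        using gp_boundary_diff[of M n 0 h] by (simp add: gp_boundary_0)
      ultimately show ?case using Kinv[OF *[OF inv]] by (simp add: gp_chains_def)
    next
      case (eng h1 h2)
      have "gp_boundary M n (h1 + h2) = gp_boundary M n h1 + gp_boundary M n h2"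
        using gp_boundary_diff[of M n "h1 + h2" h2] by simp
      then show ?case using eng by (simp add: gp_chains_def Kadd)
    qed
  qed (simp add: gp_boundary_def K0)
  have "coinv_class G M act (n - 1) (gp_boundary M n d) = coinv_class G M act (n - 1) (gp_boundary M n c)"
    if "d \<in> coinv_class G M act n c" for d
  proof -
    obtain k where k: "k \<in> ?K n" "d = k + c"
      using \<open>d \<in> coinv_class G M act n c\<close> by (auto simp: coinv_class_def r_coset_def gp_chains_def)
    have "gp_boundary M n d = gp_boundary M n k + gp_boundary M n c"
      using gp_boundary_diff[of M n d c] k by simp
    then show ?thesis
      unfolding coinv_class_def
      using group.coset_mult_assoc[OF grp subgroup.subset[OF sub]
          subgroup.mem_carrier[OF sub bK[OF k(1)]] closed[OF c]]
        group.coset_join2[OF grp subgroup.mem_carrier[OF sub bK[OF k(1)]] sub bK[OF k(1)]]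
      by (simp add: gp_chains_def)
  qed
  moreover have "c \<in> coinv_class G M act n c"
    using K0[of n] by (force simp: coinv_class_def r_coset_def gp_chains_def)
  ultimately have "(\<lambda>d. coinv_class G M act (n - 1) (gp_boundary M n d)) ` coinv_class G M act n c
      = {coinv_class G M act (n - 1) (gp_boundary M n c)}"
    by blast
  then show ?thesis by (simp add: coinv_boundary_def)
qed

definition group_cocycle ::
    "('g, 'b) monoid_scheme \<Rightarrow> ('m, 'c) ring_scheme \<Rightarrow> ('m \<Rightarrow> ('g \<Rightarrow>\<^sub>0 int) \<Rightarrow> 'm)
      \<Rightarrow> ('a, 'd) monoid_scheme \<Rightarrow> nat \<Rightarrow> (('m list \<Rightarrow>\<^sub>0 int) set \<Rightarrow> 'a) \<Rightarrow> bool" where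
  "group_cocycle G M act A n f \<longleftrightarrow>
     f \<in> hom (coinv_chains G M act n) A \<and>
     (\<forall>U \<in> carrier (coinv_chains G M act (n + 1)).
        f (coinv_boundary G M act (n + 1) U) = \<one>\<^bsub>A\<^esub>)"


section \<open>The maps \<open>\<gamma>\<close> and \<open>\<psi>\<close>\<close>

text \<open>
  Chains of the intermediate complex are integral combinations of pairs \<open>(gs, ms)\<close> of \<open>n\<close>-tuples.
\<close>

definition gamma_map ::
    "('m, 'c) ring_scheme \<Rightarrow> nat \<Rightarrow> (('m \<times> 'g) list \<Rightarrow>\<^sub>0 int) \<Rightarrow> ('g list \<times> 'm list \<Rightarrow>\<^sub>0 int)" where
  "gamma_map M n = frag_extend (\<lambda>xs. frag_of
     (map snd xs,
      map (\<lambda>i. if i < n - 1 then fst (xs ! i) \<ominus>\<^bsub>M\<^esub> fst (xs ! (i + 1)) else fst (xs ! i)) [0..<n]))"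

definition pow_prod :: "('g, 'b) monoid_scheme \<Rightarrow> 'g list \<Rightarrow> nat list \<Rightarrow> nat list \<Rightarrow> 'g" where
  "pow_prod G gs k js = foldr (\<lambda>j p. (gs ! j) [^]\<^bsub>G\<^esub> (k ! j) \<otimes>\<^bsub>G\<^esub> p) js \<one>\<^bsub>G\<^esub>"

text \<open>
  The element \<open>\<phi> (g\<^sub>1 ^ k\<^sub>1 \<dots> g\<^sub>j ^ k\<^sub>j) g\<^sub>j\<^sub>+\<^sub>1 ^ k\<^sub>j\<^sub>+\<^sub>1 \<dots> g\<^sub>n ^ k\<^sub>n\<close> for \<open>j = i + 1\<close>, as list positions count from 0.
\<close>

definition psi_elt ::
    "('g, 'b) monoid_scheme \<Rightarrow> ('g \<Rightarrow> 'g) \<Rightarrow> nat \<Rightarrow> 'g list \<Rightarrow> nat list \<Rightarrow> nat \<Rightarrow> 'g" where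
  "psi_elt G \<phi> n gs k i =
     \<phi> (pow_prod G gs k [0..<i + 1]) \<otimes>\<^bsub>G\<^esub> pow_prod G gs k [i + 1..<n]"

definition psi_map ::
    "('g, 'b) monoid_scheme \<Rightarrow> ('m, 'c) ring_scheme \<Rightarrow> ('m \<Rightarrow> ('g \<Rightarrow>\<^sub>0 int) \<Rightarrow> 'm) \<Rightarrow> ('g \<Rightarrow> 'g) \<Rightarrow> nat
      \<Rightarrow> ('g list \<times> 'm list \<Rightarrow>\<^sub>0 int) \<Rightarrow> ('m list \<Rightarrow>\<^sub>0 int) set" where
  "psi_map G M act \<phi> n c = coinv_class G M act n
     (frag_extend (\<lambda>(gs, ms). \<Sum>k \<in> {k \<in> tuples n {0, 1}. k ! 0 = 0}.
        frag_cmul ((-1) ^ sum_list k)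
          (frag_of (map (\<lambda>i. act (ms ! i) (frag_of (psi_elt G \<phi> n gs k i))) [0..<n]))) c)"

end

theory Submission
  imports Defs
begin

text \<open>
  The composite \<open>\<psi>\<^sub>n \<circ> \<gamma>\<^sub>n\<close> is a chain map from the birack complex to the coinvariants of the group
  complex, so it pulls cocycles back to cocycles. In degree \<open>n + 1\<close> it sends \<open>xs = (x\<^sub>0, \<dots>, x\<^sub>n)\<close>, with
  \<open>x\<^sub>i = (m\<^sub>i, g\<^sub>i)\<close> and positions counted from 0, to a signed sum over the exponent vectors
  \<open>k \<in> {0, 1} ^ (n + 1)\<close> with \<open>k\<^sub>0 = 0\<close>. The summand
  \<open>cell \<one> xs k\<close> is a tuple whose entries are the translated differences \<open>m\<^sub>i - m\<^sub>i\<^sub>+\<^sub>1\<close>, where the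
  entry after the last is read as 0.

  Compare the boundary of this sum with the image of the birack boundary.

  \<^item> Consider the inner group face that adds the entries \<open>i - 1\<close> and \<open>i\<close>. If \<open>k\<^sub>i = 0\<close>, the two
    entries are translated by the same group element, \<open>m\<^sub>i\<close> cancels, and what remains is the cell of
    the tuple with \<open>x\<^sub>i\<close> deleted (\<open>merge_cell_0\<close>). If \<open>k\<^sub>i = 1\<close>, the entries are translated by \<open>g\<^sub>i w\<close>
    and \<open>\<phi>(g\<^sub>i) w\<close>, and \<open>(m\<^sub>i\<^sub>-\<^sub>1 - m\<^sub>i) g\<^sub>i + (m\<^sub>i - m\<^sub>i\<^sub>+\<^sub>1) \<phi>(g\<^sub>i)\<close> is exactly the difference of
    the module parts of \<open>x\<^sub>i\<^sub>-\<^sub>1\<close> and \<open>x\<^sub>i\<^sub>+\<^sub>1\<close> after \<open>x\<^sub>i\<close> has acted by the lower and the upper operation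
    respectively (\<open>merge_cell_1\<close>). The sign of \<open>k\<close> accounts for the minus sign in the birack boundary.
    So the inner faces match the birack faces at the positions \<open>1, \<dots>, n\<close> on the nose
    (\<open>cube_chain_merge\<close>).

  \<^item> The other terms vanish in the coinvariants, since they combine into differences of two tuples that
    are translates of each other: the first group face, where changing \<open>k\<^sub>1\<close> translates by the central
    element \<open>\<phi>(g\<^sub>1)\<close> (\<open>cube_chain_tl\<close>); the last group face, where changing \<open>k\<^sub>n\<close> translates by \<open>g\<^sub>n\<close>
    (\<open>cube_chain_butlast\<close>); and the two birack faces at position 0, which differ by the translation by
    \<open>\<phi>(g\<^sub>0)\<close> (\<open>cube_chain_first_face\<close>).

  The chain map property is \<open>cube_chain_boundary\<close>. It is stated for chains of tuples, as membership of
  a difference in the subgroup of coinvariant relations.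
\<close>

section \<open>The action of the group and the biquandle operations\<close>

locale alexander_biquandle = G: group G + right_module "group_ring G" M act
  for G :: "('g, 'b) monoid_scheme" and M :: "('m, 'c) ring_scheme"
    and act :: "'m \<Rightarrow> ('g \<Rightarrow>\<^sub>0 int) \<Rightarrow> 'm" +
  fixes \<phi> :: "'g \<Rightarrow> 'g"
  assumes phi_hom: "\<phi> \<in> hom G (G\<lparr>carrier := center G\<rparr>)"
begin

abbreviation translate :: "'m \<Rightarrow> 'g \<Rightarrow> 'm" (infixl "\<triangleleft>" 72)
  where "m \<triangleleft> g \<equiv> act m (frag_of g)"

abbreviation X :: "('m \<times> 'g) set"
  where "X \<equiv> alex_carrier G M"

abbreviation under :: "'m \<times> 'g \<Rightarrow> 'm \<times> 'g \<Rightarrow> 'm \<times> 'g"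
  where "under \<equiv> alex_under G M act \<phi>"

abbreviation over :: "'m \<times> 'g \<Rightarrow> 'm \<times> 'g \<Rightarrow> 'm \<times> 'g"
  where "over \<equiv> alex_over act \<phi>"

lemma frag_of_carrier: "g \<in> carrier G \<Longrightarrow> frag_of g \<in> carrier (group_ring G)"
  by (simp add: group_ring_def)

lemma translate_closed [simp]:
  "m \<in> carrier M \<Longrightarrow> g \<in> carrier G \<Longrightarrow> m \<triangleleft> g \<in> carrier M"
  by (simp add: act_closed frag_of_carrier)

lemma translate_add:
  "m \<in> carrier M \<Longrightarrow> n \<in> carrier M \<Longrightarrow> g \<in> carrier G \<Longrightarrow>
    (m \<oplus>\<^bsub>M\<^esub> n) \<triangleleft> g = m \<triangleleft> g \<oplus>\<^bsub>M\<^esub> n \<triangleleft> g"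
  by (simp add: act_add_left frag_of_carrier)

lemma translate_mult:
  assumes "m \<in> carrier M" "g \<in> carrier G" "h \<in> carrier G"
  shows "m \<triangleleft> g \<triangleleft> h = m \<triangleleft> (g \<otimes>\<^bsub>G\<^esub> h)"
  using act_mult[of m "frag_of g" "frag_of h"] assms by (simp add: group_ring_def)

lemma translate_one [simp]: "m \<in> carrier M \<Longrightarrow> m \<triangleleft> \<one>\<^bsub>G\<^esub> = m"
  using act_one[of m] by (simp add: group_ring_def)

lemma translate_zero [simp]:
  assumes "g \<in> carrier G"
  shows "\<zero>\<^bsub>M\<^esub> \<triangleleft> g = \<zero>\<^bsub>M\<^esub>"
  using translate_add[of "\<zero>\<^bsub>M\<^esub>" "\<zero>\<^bsub>M\<^esub>" g] assms
  by (metis M.add.l_cancel_one M.zero_closed M.l_zero translate_closed)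

lemma translate_minus:
  assumes "m \<in> carrier M" "n \<in> carrier M" "g \<in> carrier G"
  shows "(m \<ominus>\<^bsub>M\<^esub> n) \<triangleleft> g = m \<triangleleft> g \<ominus>\<^bsub>M\<^esub> n \<triangleleft> g"
proof -
  have "m \<triangleleft> g = (m \<ominus>\<^bsub>M\<^esub> n \<oplus>\<^bsub>M\<^esub> n) \<triangleleft> g"
    using assms by (simp add: M.minus_eq M.a_assoc M.l_neg)
  also have "\<dots> = (m \<ominus>\<^bsub>M\<^esub> n) \<triangleleft> g \<oplus>\<^bsub>M\<^esub> n \<triangleleft> g"
    using assms by (simp add: translate_add)
  finally show ?thesis
    using assms by (simp add: M.minus_eq M.a_assoc M.r_neg)
qed

lemma act_minus_right:
  assumes "m \<in> carrier M" "g \<in> carrier G" "h \<in> carrier G"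
  shows "act m (frag_of g \<ominus>\<^bsub>group_ring G\<^esub> frag_of h) = m \<triangleleft> g \<ominus>\<^bsub>M\<^esub> m \<triangleleft> h"
proof -
  define a b where "a = frag_of g" and "b = frag_of h"
  have ab: "a \<in> carrier (group_ring G)" "b \<in> carrier (group_ring G)"
    using assms by (simp_all add: a_def b_def frag_of_carrier)
  then have d: "a \<ominus>\<^bsub>group_ring G\<^esub> b \<in> carrier (group_ring G)"
    by (rule R.minus_closed)
  have "a = (a \<ominus>\<^bsub>group_ring G\<^esub> b) \<oplus>\<^bsub>group_ring G\<^esub> b"
    unfolding R.minus_eq using ab by (simp add: R.a_assoc R.l_neg)
  then have "act m a = act m (a \<ominus>\<^bsub>group_ring G\<^esub> b) \<oplus>\<^bsub>M\<^esub> act m b"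
    using act_add_right[OF assms(1) d ab(2)] by argo
  then have "act m (a \<ominus>\<^bsub>group_ring G\<^esub> b) = act m a \<ominus>\<^bsub>M\<^esub> act m b"
    using act_closed[OF assms(1) d] act_closed[OF assms(1) ab(2)]
    by (simp add: M.minus_eq M.a_assoc M.r_neg)
  then show ?thesis by (simp add: a_def b_def)
qed

lemma center_carrier [simp]: "z \<in> center G \<Longrightarrow> z \<in> carrier G"
  unfolding center_def mem_Collect_eq by (rule conjunct1)

lemma center_commute:
  assumes "z \<in> center G" "g \<in> carrier G"
  shows "g \<otimes>\<^bsub>G\<^esub> z = z \<otimes>\<^bsub>G\<^esub> g"
proof -
  have "\<forall>g \<in> carrier G. z \<otimes>\<^bsub>G\<^esub> g = g \<otimes>\<^bsub>G\<^esub> z"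
    using assms(1) unfolding center_def mem_Collect_eq by (rule conjunct2)
  from bspec[OF this assms(2)] show ?thesis by (rule sym)
qed

lemma center_one [simp]: "\<one>\<^bsub>G\<^esub> \<in> center G"
  unfolding center_def mem_Collect_eq by (intro conjI ballI) (simp_all only: G.one_closed G.l_one G.r_one)

lemma center_mult [simp]:
  assumes "y \<in> center G" "z \<in> center G" shows "y \<otimes>\<^bsub>G\<^esub> z \<in> center G"
proof -
  have "y \<otimes>\<^bsub>G\<^esub> z \<otimes>\<^bsub>G\<^esub> g = g \<otimes>\<^bsub>G\<^esub> (y \<otimes>\<^bsub>G\<^esub> z)" if "g \<in> carrier G" for g
  proof -
    have "y \<otimes>\<^bsub>G\<^esub> z \<otimes>\<^bsub>G\<^esub> g = y \<otimes>\<^bsub>G\<^esub> g \<otimes>\<^bsub>G\<^esub> z"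
      using assms that center_commute[of z g] by (simp add: G.m_assoc)
    also have "\<dots> = g \<otimes>\<^bsub>G\<^esub> (y \<otimes>\<^bsub>G\<^esub> z)"
      using assms that center_commute[of y g, symmetric] by (simp add: G.m_assoc)
    finally show ?thesis .
  qed
  moreover have "y \<otimes>\<^bsub>G\<^esub> z \<in> carrier G" using assms by simp
  ultimately show ?thesis unfolding center_def mem_Collect_eq by (intro conjI ballI)
qed

lemma phi_center [simp]: "g \<in> carrier G \<Longrightarrow> \<phi> g \<in> center G"
  using phi_hom by (auto simp: hom_def)

lemma phi_mult: "g \<in> carrier G \<Longrightarrow> h \<in> carrier G \<Longrightarrow> \<phi> (g \<otimes>\<^bsub>G\<^esub> h) = \<phi> g \<otimes>\<^bsub>G\<^esub> \<phi> h"
  using phi_hom by (auto simp: hom_def)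

lemma phi_one [simp]: "\<phi> \<one>\<^bsub>G\<^esub> = \<one>\<^bsub>G\<^esub>"
proof -
  have "\<phi> \<one>\<^bsub>G\<^esub> \<otimes>\<^bsub>G\<^esub> \<phi> \<one>\<^bsub>G\<^esub> = \<phi> \<one>\<^bsub>G\<^esub>"
    by (subst phi_mult[symmetric]) simp_all
  then show ?thesis by (simp add: G.l_cancel_one)
qed

text \<open>
  Conjugation disappears under \<open>\<phi>\<close> because its values commute. Hence the lower operation, which
  conjugates the group parts, leaves the \<open>\<phi>\<close>-factors of a cell unchanged.
\<close>

lemma phi_conj:
  assumes "g \<in> carrier G" "h \<in> carrier G"
  shows "\<phi> (inv\<^bsub>G\<^esub> h \<otimes>\<^bsub>G\<^esub> (g \<otimes>\<^bsub>G\<^esub> h)) = \<phi> g"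
proof -
  have "\<phi> (inv\<^bsub>G\<^esub> h \<otimes>\<^bsub>G\<^esub> (g \<otimes>\<^bsub>G\<^esub> h)) = (\<phi> g \<otimes>\<^bsub>G\<^esub> \<phi> h) \<otimes>\<^bsub>G\<^esub> \<phi> (inv\<^bsub>G\<^esub> h)"
    using assms center_commute[of "\<phi> (inv\<^bsub>G\<^esub> h)" "\<phi> g \<otimes>\<^bsub>G\<^esub> \<phi> h"] by (simp add: phi_mult)
  also have "\<dots> = \<phi> g \<otimes>\<^bsub>G\<^esub> \<phi> (h \<otimes>\<^bsub>G\<^esub> inv\<^bsub>G\<^esub> h)"
    by (subst phi_mult) (use assms in \<open>simp_all add: G.m_assoc\<close>)
  finally show ?thesis using assms by simp
qed

lemma pow_conj:
  assumes "g \<in> carrier G" "h \<in> carrier G"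
  shows "(inv\<^bsub>G\<^esub> h \<otimes>\<^bsub>G\<^esub> (g \<otimes>\<^bsub>G\<^esub> h)) [^]\<^bsub>G\<^esub> (k::nat) = inv\<^bsub>G\<^esub> h \<otimes>\<^bsub>G\<^esub> (g [^]\<^bsub>G\<^esub> k \<otimes>\<^bsub>G\<^esub> h)"
proof (induction k)
  case (Suc k)
  have "h \<otimes>\<^bsub>G\<^esub> (inv\<^bsub>G\<^esub> h \<otimes>\<^bsub>G\<^esub> c) = c" if "c \<in> carrier G" for c
    using assms that by (simp add: G.m_assoc[symmetric])
  then show ?case using assms Suc by (simp add: G.m_assoc)
qed (use assms in simp)

lemma X_iff [simp]: "x \<in> X \<longleftrightarrow> fst x \<in> carrier M \<and> snd x \<in> carrier G"
  by (cases x) (simp add: alex_carrier_def)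

lemma under_simps:
  assumes "x \<in> X" "y \<in> X"
  shows "fst (under x y) = fst x \<triangleleft> snd y \<oplus>\<^bsub>M\<^esub> (fst y \<triangleleft> \<phi> (snd y) \<ominus>\<^bsub>M\<^esub> fst y \<triangleleft> snd y)"
    and "snd (under x y) = inv\<^bsub>G\<^esub> (snd y) \<otimes>\<^bsub>G\<^esub> snd x \<otimes>\<^bsub>G\<^esub> snd y"
  using assms by (simp_all add: alex_under_def case_prod_beta act_minus_right)

lemma over_simps: "fst (over x y) = fst x \<triangleleft> \<phi> (snd y)" "snd (over x y) = snd x"
  by (simp_all add: alex_over_def case_prod_beta)

lemma under_closed: "x \<in> X \<Longrightarrow> y \<in> X \<Longrightarrow> under x y \<in> X"
  by (simp add: under_simps)

lemma over_closed: "x \<in> X \<Longrightarrow> y \<in> X \<Longrightarrow> over x y \<in> X"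
  by (simp add: over_simps)

lemma set_map_under:
  assumes "set xs \<subseteq> X" "y \<in> X"
  shows "set (map (\<lambda>x. under x y) xs) \<subseteq> X"
  using assms by (induction xs) (simp_all del: X_iff add: under_closed)

lemma set_map_over:
  assumes "set xs \<subseteq> X" "y \<in> X"
  shows "set (map (\<lambda>x. over x y) xs) \<subseteq> X"
  using assms by (induction xs) (simp_all del: X_iff add: over_closed)

text \<open>
  Both module parts receive the same correction term from \<open>y\<close>, so differences of neighbouring entries
  are merely translated.
\<close>

lemma diff_under:
  assumes "x \<in> X" "x' \<in> X" "y \<in> X"
  shows "fst (under x y) \<ominus>\<^bsub>M\<^esub> fst (under x' y) = (fst x \<ominus>\<^bsub>M\<^esub> fst x') \<triangleleft> snd y"
proof -
  have "(a \<oplus>\<^bsub>M\<^esub> t) \<ominus>\<^bsub>M\<^esub> (b \<oplus>\<^bsub>M\<^esub> t) = a \<ominus>\<^bsub>M\<^esub> b"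
    if "a \<in> carrier M" "b \<in> carrier M" "t \<in> carrier M" for a b t
    using that M.a_lcomm[of t "\<ominus>\<^bsub>M\<^esub> b" "\<ominus>\<^bsub>M\<^esub> t"]
    by (simp add: M.minus_eq M.minus_add M.a_assoc M.r_neg)
  then show ?thesis using assms by (simp add: under_simps translate_minus)
qed

text \<open>
  This identity is what the correction term \<open>n (\<phi>(h) - h)\<close> in the lower operation is made for. The
  element \<open>c\<close> stands for the module part following \<open>y\<close>, or is 0 if \<open>y\<close> comes last.
\<close>

lemma diff_under_over:
  assumes "x \<in> X" "y \<in> X" "c \<in> carrier M"
  shows "fst (under x y) \<ominus>\<^bsub>M\<^esub> c \<triangleleft> \<phi> (snd y)
    = (fst x \<ominus>\<^bsub>M\<^esub> fst y) \<triangleleft> snd y \<oplus>\<^bsub>M\<^esub> (fst y \<ominus>\<^bsub>M\<^esub> c) \<triangleleft> \<phi> (snd y)"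
  using assms by (simp add: under_simps translate_minus) (simp add: M.minus_eq M.a_ac)

section \<open>Cells and their faces\<close>

text \<open>
  The value 0 at the empty list makes the last entry of a cell, which is not a difference, an instance
  of the general pattern.
\<close>

definition leading :: "('m \<times> 'g) list \<Rightarrow> 'm" where
  "leading xs = (case xs of [] \<Rightarrow> \<zero>\<^bsub>M\<^esub> | x # _ \<Rightarrow> fst x)"

fun word :: "('m \<times> 'g) list \<Rightarrow> nat list \<Rightarrow> 'g" where
  "word (x # xs) (k # ks) = snd x [^]\<^bsub>G\<^esub> k \<otimes>\<^bsub>G\<^esub> word xs ks"
| "word _ _ = \<one>\<^bsub>G\<^esub>"

text \<open>
  The summands of \<open>\<psi>\<^sub>n \<circ> \<gamma>\<^sub>n\<close>, see \<open>psi_gamma_cell\<close> below. The accumulator \<open>p\<close> collects the central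
  factors \<open>\<phi>(g\<^sub>0 ^ k\<^sub>0 \<dots>)\<close> of the entries already passed, so that statements about a face in the middle
  of a tuple can be proved by induction on the part before it.
\<close>

fun cell :: "'g \<Rightarrow> ('m \<times> 'g) list \<Rightarrow> nat list \<Rightarrow> 'm list" where
  "cell p (x # xs) (k # ks) =
     (fst x \<ominus>\<^bsub>M\<^esub> leading xs) \<triangleleft> (p \<otimes>\<^bsub>G\<^esub> \<phi> (snd x [^]\<^bsub>G\<^esub> k) \<otimes>\<^bsub>G\<^esub> word xs ks)
       # cell (p \<otimes>\<^bsub>G\<^esub> \<phi> (snd x [^]\<^bsub>G\<^esub> k)) xs ks"
| "cell _ _ _ = []"

lemma leading_simps [simp]: "leading [] = \<zero>\<^bsub>M\<^esub>" "leading (x # xs) = fst x"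
  by (simp_all add: leading_def)

lemma leading_closed [simp]: "set xs \<subseteq> X \<Longrightarrow> leading xs \<in> carrier M"
  by (cases xs) simp_all

lemma word_closed [simp]: "set xs \<subseteq> X \<Longrightarrow> word xs ks \<in> carrier G"
  by (induction xs ks rule: word.induct) simp_all

lemma word_append:
  "length xs = length ks \<Longrightarrow> set xs \<subseteq> X \<Longrightarrow> set ys \<subseteq> X \<Longrightarrow>
    word (xs @ ys) (ks @ ls) = word xs ks \<otimes>\<^bsub>G\<^esub> word ys ls"
  by (induction xs ks rule: list_induct2) (simp_all add: G.m_assoc)

lemma word_under:
  assumes "length xs = length ks" "set xs \<subseteq> X" "y \<in> X"
  shows "word (map (\<lambda>x. under x y) xs) ks = inv\<^bsub>G\<^esub> (snd y) \<otimes>\<^bsub>G\<^esub> word xs ks \<otimes>\<^bsub>G\<^esub> snd y"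
  using assms(1,2)
proof (induction xs ks rule: list_induct2)
  case (Cons x xs k ks)
  have "snd y \<otimes>\<^bsub>G\<^esub> (inv\<^bsub>G\<^esub> (snd y) \<otimes>\<^bsub>G\<^esub> c) = c" if "c \<in> carrier G" for c
    using assms(3) that by (simp add: G.m_assoc[symmetric])
  then show ?case
    using Cons assms(3) by (simp add: under_simps pow_conj G.m_assoc)
qed (use assms(3) in simp)

lemma word_over: "word (map (\<lambda>x. over x y) xs) ks = word xs ks"
  by (induction xs ks rule: word.induct) (simp_all add: over_simps)

lemma leading_over:
  "set xs \<subseteq> X \<Longrightarrow> y \<in> X \<Longrightarrow> leading (map (\<lambda>x. over x y) xs) = leading xs \<triangleleft> \<phi> (snd y)"
  by (cases xs) (simp_all add: over_simps)

lemma length_cell [simp]: "length xs = length ks \<Longrightarrow> length (cell p xs ks) = length ks"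
  by (induction xs ks arbitrary: p rule: list_induct2) simp_all

lemma cell_closed:
  "p \<in> center G \<Longrightarrow> set xs \<subseteq> X \<Longrightarrow> set (cell p xs ks) \<subseteq> carrier M"
  by (induction p xs ks rule: cell.induct) simp_all

lemma cell_mult_center:
  "length xs = length ks \<Longrightarrow> p \<in> center G \<Longrightarrow> z \<in> center G \<Longrightarrow> set xs \<subseteq> X \<Longrightarrow>
    cell (p \<otimes>\<^bsub>G\<^esub> z) xs ks = map (\<lambda>m. m \<triangleleft> z) (cell p xs ks)"
proof (induction xs ks arbitrary: p rule: list_induct2)
  case (Cons x xs k ks)
  let ?q = "\<phi> (snd x [^]\<^bsub>G\<^esub> k)"
  have q: "?q \<in> center G" using Cons.prems by simp
  have "p \<otimes>\<^bsub>G\<^esub> z \<otimes>\<^bsub>G\<^esub> ?q = p \<otimes>\<^bsub>G\<^esub> ?q \<otimes>\<^bsub>G\<^esub> z"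
    using Cons.prems q center_commute[of z ?q] by (simp add: G.m_assoc)
  moreover have "p \<otimes>\<^bsub>G\<^esub> ?q \<otimes>\<^bsub>G\<^esub> z \<otimes>\<^bsub>G\<^esub> word xs ks = p \<otimes>\<^bsub>G\<^esub> ?q \<otimes>\<^bsub>G\<^esub> word xs ks \<otimes>\<^bsub>G\<^esub> z"
    using Cons.prems q center_commute[of z "word xs ks"] by (simp add: G.m_assoc)
  ultimately show ?case
    using Cons.IH[of "p \<otimes>\<^bsub>G\<^esub> ?q"] Cons.prems q by (simp add: translate_mult)
qed simp

text \<open>
  The upper operation translates all module parts by \<open>\<phi>(h)\<close>. Being central, this factor can be moved
  to the front of the group element.
\<close>

lemma cell_over:
  "length xs = length ks \<Longrightarrow> p \<in> center G \<Longrightarrow> y \<in> X \<Longrightarrow> set xs \<subseteq> X \<Longrightarrow>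
    cell p (map (\<lambda>x. over x y) xs) ks = cell (p \<otimes>\<^bsub>G\<^esub> \<phi> (snd y)) xs ks"
proof (induction xs ks arbitrary: p rule: list_induct2)
  case (Cons x xs k ks)
  let ?q = "\<phi> (snd x [^]\<^bsub>G\<^esub> k)" and ?z = "\<phi> (snd y)"
  have q: "?q \<in> center G" "?z \<in> center G" using Cons.prems by simp_all
  have e: "p \<otimes>\<^bsub>G\<^esub> ?z \<otimes>\<^bsub>G\<^esub> ?q = p \<otimes>\<^bsub>G\<^esub> ?q \<otimes>\<^bsub>G\<^esub> ?z"
    using Cons.prems q center_commute[of ?z ?q] by (simp add: G.m_assoc)
  have "?z \<otimes>\<^bsub>G\<^esub> (p \<otimes>\<^bsub>G\<^esub> ?q \<otimes>\<^bsub>G\<^esub> word xs ks) = p \<otimes>\<^bsub>G\<^esub> ?q \<otimes>\<^bsub>G\<^esub> ?z \<otimes>\<^bsub>G\<^esub> word xs ks"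
    using Cons.prems q center_commute[of ?z "p \<otimes>\<^bsub>G\<^esub> ?q"]
    by (simp add: G.m_assoc[symmetric])
  moreover have "fst x \<triangleleft> ?z \<ominus>\<^bsub>M\<^esub> leading xs \<triangleleft> ?z = (fst x \<ominus>\<^bsub>M\<^esub> leading xs) \<triangleleft> ?z"
    using Cons.prems by (simp add: translate_minus)
  ultimately show ?case
    using Cons.IH[of "p \<otimes>\<^bsub>G\<^esub> ?q"] Cons.prems q
    by (simp add: e over_simps leading_over word_over translate_mult)
qed simp

definition merge :: "nat \<Rightarrow> 'm list \<Rightarrow> 'm list" where
  "merge i ms = take (i - 1) ms @ [ms ! (i - 1) \<oplus>\<^bsub>M\<^esub> ms ! i] @ drop (i + 1) ms"

lemma merge_Suc_0: "merge (Suc 0) (a # b # ms) = (a \<oplus>\<^bsub>M\<^esub> b) # ms"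
  by (simp add: merge_def)

lemma merge_Suc: "i > 0 \<Longrightarrow> merge (Suc i) (a # ms) = a # merge i ms"
  by (cases i) (simp_all add: merge_def)

text \<open>
  The exponent 0 at \<open>y\<close> gives the entry before \<open>y\<close> and the entry at \<open>y\<close> the same translation, so the
  sum of the two differences telescopes.
\<close>

lemma merge_cell_0:
  assumes "length xs = length ks" "xs \<noteq> []" "length zs = length ls" "p \<in> center G"
    "set xs \<subseteq> X" "y \<in> X" "set zs \<subseteq> X"
  shows "merge (length xs) (cell p (xs @ y # zs) (ks @ 0 # ls)) = cell p (xs @ zs) (ks @ ls)"
  using assms
proof (induction xs ks arbitrary: p rule: list_induct2)
  case (Cons x xs k ks)
  let ?q = "p \<otimes>\<^bsub>G\<^esub> \<phi> (snd x [^]\<^bsub>G\<^esub> k)"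
  have q: "?q \<in> center G" using Cons.prems by simp
  show ?case
  proof (cases xs)
    case Nil
    have "(fst x \<ominus>\<^bsub>M\<^esub> fst y) \<oplus>\<^bsub>M\<^esub> (fst y \<ominus>\<^bsub>M\<^esub> leading zs) = fst x \<ominus>\<^bsub>M\<^esub> leading zs"
      using Cons.prems by (simp add: M.minus_eq M.a_assoc M.r_neg1)
    then have "(fst x \<ominus>\<^bsub>M\<^esub> fst y) \<triangleleft> (?q \<otimes>\<^bsub>G\<^esub> word zs ls)
        \<oplus>\<^bsub>M\<^esub> (fst y \<ominus>\<^bsub>M\<^esub> leading zs) \<triangleleft> (?q \<otimes>\<^bsub>G\<^esub> word zs ls)
        = (fst x \<ominus>\<^bsub>M\<^esub> leading zs) \<triangleleft> (?q \<otimes>\<^bsub>G\<^esub> word zs ls)"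
      using Cons.prems q translate_add[of "fst x \<ominus>\<^bsub>M\<^esub> fst y" "fst y \<ominus>\<^bsub>M\<^esub> leading zs"]
      by simp
    then show ?thesis
      using Nil Cons.hyps Cons.prems q by (simp add: merge_Suc_0)
  next
    case (Cons x' xs')
    have "word (xs @ y # zs) (ks @ 0 # ls) = word (xs @ zs) (ks @ ls)"
      using Cons.hyps Cons.prems by (simp add: word_append)
    moreover have "leading (xs @ y # zs) = leading (xs @ zs)"
      using Cons by simp
    moreover have "length ks > 0" using Cons Cons.hyps by auto
    ultimately show ?thesis
      using Cons.IH[of ?q] Cons.hyps Cons.prems q Cons by (simp add: merge_Suc)
  qed
qed simp

text \<open>
  With the exponent 1, the factor \<open>h = snd y\<close> occurs as \<open>h\<close> in the words of the entries before \<open>y\<close> and as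
  \<open>\<phi>(h)\<close> in those from \<open>y\<close> on. Moved to the left, the former conjugates the words and translates the
  differences before \<open>y\<close>, as the lower operation does, and the latter translates the differences
  after \<open>y\<close>, as the upper operation does.
\<close>

lemma merge_cell_1:
  assumes "length xs = length ks" "xs \<noteq> []" "length zs = length ls" "p \<in> center G"
    "set xs \<subseteq> X" "y \<in> X" "set zs \<subseteq> X"
  shows "merge (length xs) (cell p (xs @ y # zs) (ks @ 1 # ls))
    = cell p (map (\<lambda>x. under x y) xs @ map (\<lambda>x. over x y) zs) (ks @ ls)"
  using assms
proof (induction xs ks arbitrary: p rule: list_induct2)
  case (Cons x xs k ks)
  let ?q = "p \<otimes>\<^bsub>G\<^esub> \<phi> (snd x [^]\<^bsub>G\<^esub> k)" and ?h = "snd y"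
  have q: "?q \<in> center G" "?h \<in> carrier G" using Cons.prems by simp_all
  have phi: "\<phi> (snd (under x y) [^]\<^bsub>G\<^esub> k) = \<phi> (snd x [^]\<^bsub>G\<^esub> k)"
    using Cons.prems by (simp add: under_simps pow_conj phi_conj G.m_assoc)
  have comm: "?q \<otimes>\<^bsub>G\<^esub> (g \<otimes>\<^bsub>G\<^esub> w) = g \<otimes>\<^bsub>G\<^esub> (?q \<otimes>\<^bsub>G\<^esub> w)"
    if "g \<in> carrier G" "w \<in> carrier G" for g w
    using center_commute[OF q(1) that(1)] that q by (simp add: G.m_assoc[symmetric])
  show ?case
  proof (cases xs)
    case Nil
    let ?w = "?q \<otimes>\<^bsub>G\<^esub> word zs ls"
    have w: "?w \<in> carrier G" using q Cons.prems by simp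
    have "(fst x \<ominus>\<^bsub>M\<^esub> fst y) \<triangleleft> (?q \<otimes>\<^bsub>G\<^esub> (?h \<otimes>\<^bsub>G\<^esub> word zs ls))
        \<oplus>\<^bsub>M\<^esub> (fst y \<ominus>\<^bsub>M\<^esub> leading zs) \<triangleleft> (?q \<otimes>\<^bsub>G\<^esub> (\<phi> ?h \<otimes>\<^bsub>G\<^esub> word zs ls))
        = (fst x \<ominus>\<^bsub>M\<^esub> fst y) \<triangleleft> ?h \<triangleleft> ?w \<oplus>\<^bsub>M\<^esub> (fst y \<ominus>\<^bsub>M\<^esub> leading zs) \<triangleleft> \<phi> ?h \<triangleleft> ?w"
      using Cons.prems q w by (simp only: comm word_closed center_carrier phi_center) (simp add: translate_mult)
    also have "\<dots> = (fst (under x y) \<ominus>\<^bsub>M\<^esub> leading zs \<triangleleft> \<phi> ?h) \<triangleleft> ?w"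
      using Cons.prems q w by (simp add: diff_under_over translate_add)
    finally have "(fst x \<ominus>\<^bsub>M\<^esub> fst y) \<triangleleft> (?q \<otimes>\<^bsub>G\<^esub> (?h \<otimes>\<^bsub>G\<^esub> word zs ls))
        \<oplus>\<^bsub>M\<^esub> (fst y \<ominus>\<^bsub>M\<^esub> leading zs) \<triangleleft> (?q \<otimes>\<^bsub>G\<^esub> \<phi> ?h \<otimes>\<^bsub>G\<^esub> word zs ls)
        = (fst (under x y) \<ominus>\<^bsub>M\<^esub> leading zs \<triangleleft> \<phi> ?h) \<triangleleft> ?w"
      using Cons.prems q by (simp add: G.m_assoc)
    then show ?thesis
      using Nil Cons.hyps Cons.prems q
      by (simp add: merge_Suc_0 phi word_over leading_over cell_over)
  next
    case (Cons x' xs')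
    let ?u = "map (\<lambda>x. under x y) xs" and ?o = "map (\<lambda>x. over x y) zs"
    have X': "set ?u \<subseteq> X" "set ?o \<subseteq> X"
      using Cons.prems by (simp_all add: set_map_under set_map_over del: X_iff set_map)
    have inv: "?h \<otimes>\<^bsub>G\<^esub> (inv\<^bsub>G\<^esub> ?h \<otimes>\<^bsub>G\<^esub> c) = c" if "c \<in> carrier G" for c
      using q that by (simp add: G.m_assoc[symmetric])
    \<comment> \<open>The conjugated word is \<open>h\<inverse> v h w\<close>, so a factor \<open>h\<close> in front turns it into \<open>v h w\<close>.\<close>
    have "?h \<otimes>\<^bsub>G\<^esub> word (?u @ ?o) (ks @ ls) = word (xs @ y # zs) (ks @ 1 # ls)"
      using Cons.hyps Cons.prems q X'
      by (simp add: word_append word_under word_over G.m_assoc inv)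
    then have "?h \<otimes>\<^bsub>G\<^esub> (?q \<otimes>\<^bsub>G\<^esub> word (?u @ ?o) (ks @ ls))
        = ?q \<otimes>\<^bsub>G\<^esub> word (xs @ y # zs) (ks @ 1 # ls)"
      using comm[of ?h "word (?u @ ?o) (ks @ ls)"] q X' by simp
    moreover have "fst (under x y) \<ominus>\<^bsub>M\<^esub> leading (?u @ ?o)
        = (fst x \<ominus>\<^bsub>M\<^esub> leading (xs @ y # zs)) \<triangleleft> ?h"
      using Cons.prems Cons diff_under[of x x' y] by simp
    moreover have "length ks > 0" using Cons Cons.hyps by auto
    ultimately show ?thesis
      using Cons.IH[of ?q] Cons.hyps Cons.prems q Cons X'
      by (simp add: merge_Suc phi translate_mult)
  qed
qed simp

lemma tl_cell:
  assumes "length zs = length ls" "x \<in> X" "y \<in> X" "set zs \<subseteq> X"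
  shows "tl (cell \<one>\<^bsub>G\<^esub> (x # y # zs) (0 # 1 # ls))
    = map (\<lambda>m. m \<triangleleft> \<phi> (snd y)) (tl (cell \<one>\<^bsub>G\<^esub> (x # y # zs) (0 # 0 # ls)))"
  using assms cell_mult_center[of zs ls "\<one>\<^bsub>G\<^esub>" "\<phi> (snd y)"]
    center_commute[of "\<phi> (snd y)" "word zs ls"]
  by (simp add: translate_mult)

lemma butlast_cell:
  assumes "length xs = length ks" "p \<in> center G" "set xs \<subseteq> X" "y \<in> X"
  shows "butlast (cell p (xs @ [y]) (ks @ [1]))
    = map (\<lambda>m. m \<triangleleft> snd y) (butlast (cell p (xs @ [y]) (ks @ [0])))"
  using assms
proof (induction xs ks arbitrary: p rule: list_induct2)
  case (Cons x xs k ks)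
  have ne: "cell p' (xs @ [y]) (ks @ [j]) \<noteq> []" for p' j
    using length_cell[of "xs @ [y]" "ks @ [j]" p'] Cons.hyps by force
  show ?case
    using Cons ne by (simp add: word_append translate_mult G.m_assoc)
qed simp

lemma nth_cell:
  "length xs = length ks \<Longrightarrow> p \<in> center G \<Longrightarrow> set xs \<subseteq> X \<Longrightarrow> i < length xs \<Longrightarrow>
    cell p xs ks ! i = (fst (xs ! i) \<ominus>\<^bsub>M\<^esub> leading (drop (Suc i) xs))
      \<triangleleft> (p \<otimes>\<^bsub>G\<^esub> \<phi> (word (take (Suc i) xs) (take (Suc i) ks))
          \<otimes>\<^bsub>G\<^esub> word (drop (Suc i) xs) (drop (Suc i) ks))"
proof (induction xs ks arbitrary: p i rule: list_induct2)
  case (Cons x xs k ks)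
  have "set (take j xs) \<subseteq> X" for j
    using Cons.prems set_take_subset[of j xs] by (auto simp del: X_iff)
  then show ?case
    using Cons by (cases i) (simp_all add: phi_mult G.m_assoc del: take_Suc_Cons add: take_Suc_Cons)
qed simp

lemma pow_prod_eq_word:
  assumes "set js \<subseteq> {..<length xs}"
  shows "pow_prod G (map snd xs) k js = word (map ((!) xs) js) (map ((!) k) js)"
  using assms by (induction js) (simp_all add: pow_prod_def)

text \<open>
  The left-hand side is the summand for \<open>k\<close> in \<open>\<psi>\<^sub>n (\<gamma>\<^sub>n xs)\<close>, unfolded.
\<close>

lemma psi_gamma_cell:
  assumes xs: "xs \<in> tuples n X" and k: "length k = n"
  shows "map (\<lambda>i. act (map (\<lambda>i. if i < n - 1 then fst (xs ! i) \<ominus>\<^bsub>M\<^esub> fst (xs ! (i + 1))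
            else fst (xs ! i)) [0..<n] ! i) (frag_of (psi_elt G \<phi> n (map snd xs) k i))) [0..<n]
    = cell \<one>\<^bsub>G\<^esub> xs k" (is "?l = _")
proof (rule nth_equalityI)
  have len: "length xs = n" and sub: "set xs \<subseteq> X"
    using xs by (simp_all add: tuples_def del: X_iff)
  show "length ?l = length (cell \<one>\<^bsub>G\<^esub> xs k)"
    using len k by simp
  fix i assume "i < length ?l"
  then have i: "i < n" by simp
  have takes: "map ((!) l) [0..<Suc i] = take (Suc i) l" "map ((!) l) [Suc i..<n] = drop (Suc i) l"
    if "length l = n" for l :: "'z list"
    using that i by (auto intro!: nth_equalityI simp del: upt_Suc)
  have elt: "psi_elt G \<phi> n (map snd xs) k i =
      \<phi> (word (take (Suc i) xs) (take (Suc i) k)) \<otimes>\<^bsub>G\<^esub> word (drop (Suc i) xs) (drop (Suc i) k)"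
    unfolding psi_elt_def using i len k
    by (subst (1 2) pow_prod_eq_word) (auto simp: takes simp del: upt_Suc)
  have delta: "(if i < n - 1 then fst (xs ! i) \<ominus>\<^bsub>M\<^esub> fst (xs ! (i + 1)) else fst (xs ! i))
      = fst (xs ! i) \<ominus>\<^bsub>M\<^esub> leading (drop (Suc i) xs)"
  proof (cases "i < n - 1")
    case True
    then show ?thesis using len by (simp add: Cons_nth_drop_Suc[symmetric])
  next
    case False
    have "xs ! i \<in> X"
      by (rule subsetD[OF sub]) (use i len in simp)
    then show ?thesis using False i len by (simp add: M.minus_eq)
  qed
  have "set (take (Suc i) xs) \<subseteq> X"
    using sub set_take_subset[of "Suc i" xs] by (auto simp del: X_iff)
  then have "cell \<one>\<^bsub>G\<^esub> xs k ! i = (if i < n - 1 then fst (xs ! i) \<ominus>\<^bsub>M\<^esub> fst (xs ! (i + 1))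
      else fst (xs ! i)) \<triangleleft> psi_elt G \<phi> n (map snd xs) k i"
    unfolding delta elt using i len k sub by (simp add: nth_cell)
  then show "?l ! i = cell \<one>\<^bsub>G\<^esub> xs k ! i"
    using i by simp
qed

section \<open>Signed sums over the cube\<close>

definition exponents :: "nat \<Rightarrow> nat list set" where
  "exponents n = {k \<in> tuples n {0, 1}. k ! 0 = 0}"

definition insert_at :: "nat \<Rightarrow> 'k \<Rightarrow> 'k list \<Rightarrow> 'k list" where
  "insert_at j e k = take j k @ e # drop j k"

definition signed_sum :: "nat \<Rightarrow> (nat list \<Rightarrow> 'z \<Rightarrow>\<^sub>0 int) \<Rightarrow> 'z \<Rightarrow>\<^sub>0 int" where
  "signed_sum n h = (\<Sum>k \<in> exponents n. frag_cmul ((-1) ^ sum_list k) (h k))"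

lemma exponents_length: "k \<in> exponents n \<Longrightarrow> length k = n"
  by (simp add: exponents_def tuples_def)

lemma finite_exponents: "finite (exponents n)"
  using finite_lists_length_eq[of "{0, 1 :: nat}" n]
  by (auto simp: exponents_def tuples_def conj_commute elim: rev_finite_subset)

lemma exponents_Suc:
  assumes "1 \<le> j" "j \<le> n"
  shows "exponents (Suc n) = insert_at j 0 ` exponents n \<union> insert_at j 1 ` exponents n" (is "_ = ?R")
proof (intro equalityI subsetI)
  fix k assume k: "k \<in> exponents (Suc n)"
  define k' where "k' = take j k @ drop (Suc j) k"
  have len: "length k = Suc n" using k by (rule exponents_length)
  have 01: "set k \<subseteq> {0, 1}" and k0: "k ! 0 = 0" using k by (auto simp: exponents_def tuples_def)
  have "k = insert_at j (k ! j) k'"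
    using len assms id_take_nth_drop[of j k] by (simp add: insert_at_def k'_def)
  moreover have "k ! j \<in> {0, 1}"
    by (rule subsetD[OF 01]) (use len assms in simp)
  moreover have "set k' \<subseteq> {0, 1}"
    using 01 set_take_subset[of j k] set_drop_subset[of "Suc j" k] by (auto simp: k'_def)
  then have "k' \<in> exponents n"
    using k0 len assms by (simp add: exponents_def tuples_def k'_def nth_append)
  ultimately show "k \<in> ?R" by auto
next
  fix k assume "k \<in> ?R"
  then obtain e k' where k: "k = insert_at j e k'" "e \<in> {0, 1}" "k' \<in> exponents n" by auto
  then have "set k' \<subseteq> {0, 1}" "length k' = n" "k' ! 0 = 0" by (auto simp: exponents_def tuples_def)
  moreover have "set k \<subseteq> insert e (set k')"
    using set_take_subset[of j k'] set_drop_subset[of j k'] by (auto simp: k(1) insert_at_def)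
  ultimately show "k \<in> exponents (Suc n)"
    using k(1,2) assms by (auto simp: exponents_def tuples_def insert_at_def nth_append)
qed

lemma insert_at_eq_iff:
  assumes "length k = length k'" "j \<le> length k"
  shows "insert_at j e k = insert_at j e' k' \<longleftrightarrow> e = e' \<and> k = k'"
proof
  assume "insert_at j e k = insert_at j e' k'"
  then have "take j k = take j k' \<and> e # drop j k = e' # drop j k'"
    unfolding insert_at_def by (subst (asm) append_eq_append_conv) (use assms in simp_all)
  then show "e = e' \<and> k = k'"
    by (metis append_take_drop_id list.inject)
qed simp

text \<open>
  Pairing the two exponent vectors that differ only at position \<open>j\<close> turns a sum over the cube into a
  sum of differences over a cube of one dimension less. The position 0 is excluded because its exponent
  is fixed. For every face of the boundary this is the step that creates either the two terms of a
  birack face or a cancelling pair.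
\<close>

lemma signed_sum_insert:
  fixes h :: "nat list \<Rightarrow> 'z \<Rightarrow>\<^sub>0 int"
  assumes "1 \<le> j" "j \<le> n"
  shows "signed_sum (Suc n) h = signed_sum n (\<lambda>k. h (insert_at j 0 k) - h (insert_at j 1 k))"
proof -
  let ?g = "\<lambda>k. frag_cmul ((-1) ^ sum_list k) (h k)"
  have inj: "inj_on (insert_at j e) (exponents n)" for e :: nat
    using assms by (intro inj_onI) (simp add: insert_at_eq_iff exponents_length)
  have disj: "insert_at j 0 ` exponents n \<inter> insert_at j 1 ` exponents n = {}"
    using assms by (auto simp: insert_at_eq_iff exponents_length)
  have sign: "sum_list (insert_at j e k) = e + sum_list k" for e :: nat and k
  proof -
    have "sum_list k = sum_list (take j k) + sum_list (drop j k)"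
      by (metis append_take_drop_id sum_list_append)
    then show ?thesis by (simp add: insert_at_def)
  qed
  have "signed_sum (Suc n) h = sum ?g (insert_at j 0 ` exponents n) + sum ?g (insert_at j 1 ` exponents n)"
    unfolding signed_sum_def exponents_Suc[OF assms]
    by (rule sum.union_disjoint) (use finite_exponents disj in auto)
  also have "\<dots> = (\<Sum>k \<in> exponents n. ?g (insert_at j 0 k)) + (\<Sum>k \<in> exponents n. ?g (insert_at j 1 k))"
    by (simp only: sum.reindex[OF inj] o_def)
  also have "\<dots> = (\<Sum>k \<in> exponents n. ?g (insert_at j 0 k) + ?g (insert_at j 1 k))"
    by (rule sum.distrib[symmetric])
  also have "\<dots> = signed_sum n (\<lambda>k. h (insert_at j 0 k) - h (insert_at j 1 k))"
    unfolding signed_sum_def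
  proof (rule sum.cong[OF refl])
    fix k
    have "frag_cmul c (a - b) = frag_cmul c a + frag_cmul (- c) b" for c and a b :: "'z \<Rightarrow>\<^sub>0 int"
      using frag_cmul_distrib2[of c "a - b" b] frag_cmul_distrib[of c "- c" b] by (simp add: algebra_simps)
    then show "?g (insert_at j 0 k) + ?g (insert_at j 1 k)
        = frag_cmul ((-1) ^ sum_list k) (h (insert_at j 0 k) - h (insert_at j 1 k))"
      by (simp add: sign)
  qed
  finally show ?thesis .
qed

lemma signed_sum_cong: "(\<And>k. k \<in> exponents n \<Longrightarrow> h k = h' k) \<Longrightarrow> signed_sum n h = signed_sum n h'"
  unfolding signed_sum_def by (rule sum.cong) simp_all

lemma signed_sum_add: "signed_sum n (\<lambda>k. a k + b k) = signed_sum n a + signed_sum n b"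
  by (simp add: signed_sum_def frag_cmul_distrib2 sum.distrib)

lemma signed_sum_diff: "signed_sum n (\<lambda>k. a k - b k) = signed_sum n a - signed_sum n b"
  using signed_sum_add[of n "\<lambda>k. a k - b k" b] by simp

lemma signed_sum_cmul: "signed_sum n (\<lambda>k. frag_cmul c (a k)) = frag_cmul c (signed_sum n a)"
  by (simp add: signed_sum_def frag_cmul_sum mult.commute)

lemma signed_sum_sum:
  "signed_sum n (\<lambda>k. \<Sum>i\<in>I. a i k) = (\<Sum>i\<in>I. signed_sum n (a i))"
proof -
  have "signed_sum n (\<lambda>k. \<Sum>i\<in>I. a i k)
      = (\<Sum>k\<in>exponents n. \<Sum>i\<in>I. frag_cmul ((-1) ^ sum_list k) (a i k))"
    unfolding signed_sum_def by (rule sum.cong[OF refl]) (simp only: frag_cmul_sum o_def)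
  also have "\<dots> = (\<Sum>i\<in>I. signed_sum n (a i))"
    unfolding signed_sum_def by (rule sum.swap)
  finally show ?thesis .
qed

lemma frag_extend_signed_sum:
  "frag_extend F (signed_sum n h) = signed_sum n (\<lambda>k. frag_extend F (h k))"
  by (simp add: signed_sum_def frag_extend_sum[OF finite_exponents] frag_extend_cmul o_def)

section \<open>The coinvariant relations\<close>

abbreviation relations :: "nat \<Rightarrow> ('m list \<Rightarrow>\<^sub>0 int) set" where
  "relations \<equiv> coinv_relations G M act"

lemma group_gp_chains: "group (gp_chains M n)" and comm_group_gp_chains: "comm_group (gp_chains M n)"
  by (simp_all add: gp_chains_def abelian_free_Abelian_group)

lemma relations_subgroup: "subgroup (relations n) (gp_chains M n)"
  unfolding coinv_relations_def
  by (rule group.generate_is_subgroup[OF group_gp_chains])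
    (auto simp: gp_chains_def tuples_def subset_iff dest!: subsetD[OF keys_diff] split: if_splits)

lemma relations_zero: "0 \<in> relations n"
  using subgroup.one_closed[OF relations_subgroup[of n]] by (simp add: gp_chains_def)

lemma relations_add: "a \<in> relations n \<Longrightarrow> b \<in> relations n \<Longrightarrow> a + b \<in> relations n"
  using subgroup.m_closed[OF relations_subgroup, of a n b] by (simp add: gp_chains_def)

lemma relations_uminus: "a \<in> relations n \<Longrightarrow> - a \<in> relations n"
  using subgroup.m_inv_closed[OF relations_subgroup, of a n]
    subgroup.mem_carrier[OF relations_subgroup, of a n]
  by (simp add: gp_chains_def)

lemma relations_diff: "a \<in> relations n \<Longrightarrow> b \<in> relations n \<Longrightarrow> a - b \<in> relations n"
  using relations_add[OF _ relations_uminus, of a n b] by simp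

lemma relations_cmul: "a \<in> relations n \<Longrightarrow> frag_cmul c a \<in> relations n"
  by (rule frag_closure_minus_cmul) (use relations_zero relations_diff in auto)

lemma relations_signed_sum:
  assumes "\<And>k. k \<in> exponents n \<Longrightarrow> h k \<in> relations m"
  shows "signed_sum n h \<in> relations m"
  unfolding signed_sum_def
  using finite_exponents assms
proof (induction rule: finite_induct)
  case (insert k F)
  then show ?case by (simp add: relations_add relations_cmul)
qed (simp add: relations_zero)

lemma relations_translate:
  assumes "n \<ge> 1" "length ms = n" "set ms \<subseteq> carrier M" "g \<in> carrier G"
  shows "frag_of ms - frag_of (map (\<lambda>m. m \<triangleleft> g) ms) \<in> relations n"
proof -
  have "frag_of (map (\<lambda>m. m \<triangleleft> g) ms) - frag_of ms \<in> relations n"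
    unfolding coinv_relations_def using assms
    by (intro generate.incl) (auto simp: tuples_def)
  from relations_uminus[OF this] show ?thesis by simp
qed

section \<open>The chain map\<close>

definition cube_chain :: "nat \<Rightarrow> ('m \<times> 'g) list \<Rightarrow> 'm list \<Rightarrow>\<^sub>0 int" where
  "cube_chain n xs = signed_sum n (\<lambda>k. frag_of (cell \<one>\<^bsub>G\<^esub> xs k))"

definition face_delete :: "nat \<Rightarrow> ('m \<times> 'g) list \<Rightarrow> ('m \<times> 'g) list" where
  "face_delete i xs = take i xs @ drop (Suc i) xs"

definition face_act :: "nat \<Rightarrow> ('m \<times> 'g) list \<Rightarrow> ('m \<times> 'g) list" where
  "face_act i xs = map (\<lambda>x. under x (xs ! i)) (take i xs) @ map (\<lambda>x. over x (xs ! i)) (drop (Suc i) xs)"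

lemma faces_closed:
  assumes "xs \<in> tuples (Suc n) X" "i \<le> n"
  shows "face_delete i xs \<in> tuples n X" "face_act i xs \<in> tuples n X"
proof -
  have sub: "set xs \<subseteq> X" and len: "length xs = Suc n"
    using assms by (simp_all add: tuples_def del: X_iff)
  have "set (take i xs) \<subseteq> X" "set (drop (Suc i) xs) \<subseteq> X"
    using sub set_take_subset[of i xs] set_drop_subset[of "Suc i" xs] by blast+
  moreover have "xs ! i \<in> X"
    by (rule subsetD[OF sub]) (use assms len in simp)
  ultimately show "face_delete i xs \<in> tuples n X" "face_act i xs \<in> tuples n X"
    using assms(2) len set_map_under[of "take i xs" "xs ! i"] set_map_over[of "drop (Suc i) xs" "xs ! i"]
    by (simp_all add: tuples_def face_delete_def face_act_def del: X_iff set_map)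
qed

text \<open>
  Pair the exponent vectors at position \<open>i\<close>: the exponent 0 yields the deletion face and the exponent 1,
  which carries the opposite sign, the face on which \<open>x\<^sub>i\<close> acts.
\<close>

lemma cube_chain_merge:
  assumes xs: "xs \<in> tuples (Suc n) X" and i: "1 \<le> i" "i \<le> n"
  shows "signed_sum (Suc n) (\<lambda>k. frag_of (merge i (cell \<one>\<^bsub>G\<^esub> xs k)))
    = cube_chain n (face_delete i xs) - cube_chain n (face_act i xs)"
proof -
  have sub: "set xs \<subseteq> X" and len: "length xs = Suc n"
    using xs by (simp_all add: tuples_def del: X_iff)
  have split: "xs = take i xs @ xs ! i # drop (Suc i) xs"
    using i len by (intro id_take_nth_drop) simp
  have closed: "set (take i xs) \<subseteq> X" "set (drop (Suc i) xs) \<subseteq> X"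
    using sub set_take_subset[of i xs] set_drop_subset[of "Suc i" xs] by blast+
  have y: "xs ! i \<in> X"
    by (rule subsetD[OF sub]) (use i len in simp)
  have "merge i (cell \<one>\<^bsub>G\<^esub> xs (insert_at i 0 k)) = cell \<one>\<^bsub>G\<^esub> (face_delete i xs) k
      \<and> merge i (cell \<one>\<^bsub>G\<^esub> xs (insert_at i 1 k)) = cell \<one>\<^bsub>G\<^esub> (face_act i xs) k"
    if "k \<in> exponents n" for k
  proof -
    have l: "length (take i xs) = length (take i k)" "take i xs \<noteq> []"
      "length (drop (Suc i) xs) = length (drop i k)" "length (take i xs) = i"
      using i len exponents_length[OF that] by auto
    show ?thesis
      using merge_cell_0[OF l(1,2,3) center_one closed(1) y closed(2)]
        merge_cell_1[OF l(1,2,3) center_one closed(1) y closed(2)]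
      unfolding l(4) split[symmetric] insert_at_def face_delete_def face_act_def
      by simp
  qed
  then show ?thesis
    unfolding cube_chain_def signed_sum_insert[OF i] signed_sum_diff[symmetric]
    by (intro signed_sum_cong) simp
qed

text \<open>
  Since the exponent at position 0 is 0, the entry \<open>x\<close> at that position contributes no group element
  to the others. Without its first entry, the cell depends on the exponent at position 1 only through
  the common central factor \<open>\<phi>(g\<^sub>1)\<close>.
\<close>

lemma cube_chain_tl:
  assumes xs: "xs \<in> tuples (Suc n) X" and n: "1 \<le> n"
  shows "signed_sum (Suc n) (\<lambda>k. frag_of (tl (cell \<one>\<^bsub>G\<^esub> xs k))) \<in> relations n"
  unfolding signed_sum_insert[OF order_refl n]
proof (rule relations_signed_sum)
  fix k assume k: "k \<in> exponents n"
  have sub: "set xs \<subseteq> X" and len: "length xs = Suc n"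
    using xs by (simp_all add: tuples_def del: X_iff)
  obtain x y zs where xyz: "xs = x # y # zs"
    using len n by (cases xs; cases "tl xs") auto
  obtain ls where ls: "k = 0 # ls"
    using k n by (cases k) (auto simp: exponents_def tuples_def)
  have X: "x \<in> X" "y \<in> X" "set zs \<subseteq> X" using sub xyz by simp_all
  have l: "length zs = length ls" using len exponents_length[OF k] xyz ls by simp
  let ?c = "cell \<one>\<^bsub>G\<^esub> (x # y # zs) (0 # 0 # ls)"
  have "length (tl ?c) = n" using l len xyz by simp
  moreover have "set (tl ?c) \<subseteq> carrier M"
    using cell_closed[OF center_one, of xs "0 # 0 # ls"] sub xyz by simp
  moreover have "\<phi> (snd y) \<in> carrier G" using X by simp
  ultimately show "frag_of (tl (cell \<one>\<^bsub>G\<^esub> xs (insert_at 1 0 k)))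
      - frag_of (tl (cell \<one>\<^bsub>G\<^esub> xs (insert_at 1 1 k))) \<in> relations n"
    using relations_translate[OF n, of "tl ?c" "\<phi> (snd y)"] tl_cell[OF l X]
    by (simp add: xyz ls insert_at_def)
qed

text \<open>
  All entries but the last have the factor \<open>g\<^sub>n ^ k\<^sub>n\<close> at the right end of their group element.
\<close>

lemma cube_chain_butlast:
  assumes xs: "xs \<in> tuples (Suc n) X" and n: "1 \<le> n"
  shows "signed_sum (Suc n) (\<lambda>k. frag_of (butlast (cell \<one>\<^bsub>G\<^esub> xs k))) \<in> relations n"
  unfolding signed_sum_insert[OF n order_refl]
proof (rule relations_signed_sum)
  fix k assume k: "k \<in> exponents n"
  have sub: "set xs \<subseteq> X" and len: "length xs = Suc n"
    using xs by (simp_all add: tuples_def del: X_iff)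
  obtain ys y where xyz: "xs = ys @ [y]"
    using len by (cases xs rule: rev_cases) auto
  have X: "set ys \<subseteq> X" "y \<in> X" using sub xyz by simp_all
  have l: "length ys = length k" and lk: "length k = n" using len exponents_length[OF k] xyz by simp_all
  let ?c = "butlast (cell \<one>\<^bsub>G\<^esub> (ys @ [y]) (k @ [0]))"
  have "length ?c = n" using l lk by simp
  moreover have "set ?c \<subseteq> carrier M"
    using cell_closed[OF center_one, of xs "k @ [0]"] sub xyz by (auto dest: in_set_butlastD)
  moreover have "snd y \<in> carrier G" using X by simp
  ultimately show "frag_of (butlast (cell \<one>\<^bsub>G\<^esub> xs (insert_at n 0 k)))
      - frag_of (butlast (cell \<one>\<^bsub>G\<^esub> xs (insert_at n 1 k))) \<in> relations n"
    using relations_translate[OF n, of ?c "snd y"] butlast_cell[OF l center_one X]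
    by (simp add: xyz lk insert_at_def)
qed

text \<open>
  At position 0 no entry precedes \<open>x\<^sub>0\<close>, so the lower operation does not occur and the two faces differ
  by the translation by \<open>\<phi>(g\<^sub>0)\<close>.
\<close>

lemma cube_chain_first_face:
  assumes xs: "xs \<in> tuples (Suc n) X" and n: "1 \<le> n"
  shows "cube_chain n (face_delete 0 xs) - cube_chain n (face_act 0 xs) \<in> relations n"
  unfolding cube_chain_def signed_sum_diff[symmetric]
proof (rule relations_signed_sum)
  fix k assume k: "k \<in> exponents n"
  have sub: "set xs \<subseteq> X" and len: "length xs = Suc n"
    using xs by (simp_all add: tuples_def del: X_iff)
  obtain y zs where xyz: "xs = y # zs" using len by (cases xs) auto
  have X: "y \<in> X" "set zs \<subseteq> X" using sub xyz by simp_all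
  have l: "length zs = length k" and lk: "length k = n" using len exponents_length[OF k] xyz by simp_all
  have z: "\<phi> (snd y) \<in> center G" using X by simp
  have "cell \<one>\<^bsub>G\<^esub> (map (\<lambda>x. over x y) zs) k = map (\<lambda>m. m \<triangleleft> \<phi> (snd y)) (cell \<one>\<^bsub>G\<^esub> zs k)"
    using cell_over[OF l center_one X] cell_mult_center[OF l center_one z X(2)] by simp
  then show "frag_of (cell \<one>\<^bsub>G\<^esub> (face_delete 0 xs) k) - frag_of (cell \<one>\<^bsub>G\<^esub> (face_act 0 xs) k) \<in> relations n"
    using relations_translate[OF n _ cell_closed[OF center_one X(2), of k], of "\<phi> (snd y)"] l lk z
    by (simp add: xyz face_delete_def face_act_def)
qed

lemma cube_chain_boundary_generator:
  assumes xs: "xs \<in> tuples (Suc n) X" and n: "1 \<le> n"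
  shows "frag_extend (cube_chain n) (birack_boundary under over (Suc n) (frag_of xs))
    - gp_boundary M (Suc n) (cube_chain (Suc n) xs) \<in> relations n"
proof -
  let ?D = "\<lambda>i. cube_chain n (face_delete i xs) - cube_chain n (face_act i xs)"
  let ?S = "\<lambda>h. signed_sum (Suc n) (\<lambda>k. frag_of (h (cell \<one>\<^bsub>G\<^esub> xs k)))"
  let ?E = "\<Sum>i = 1..n. frag_cmul ((-1) ^ i) (?D i)"
  have "frag_extend (cube_chain n) (birack_boundary under over (Suc n) (frag_of xs))
      = (\<Sum>i<Suc n. frag_cmul ((-1) ^ i) (?D i))"
    using n by (simp add: birack_boundary_def frag_extend_sum frag_extend_cmul frag_extend_diff o_def
        face_delete_def face_act_def del: sum.lessThan_Suc)
  also have "\<dots> = ?D 0 + ?E"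
    by (simp add: lessThan_Suc_atMost atMost_atLeast0 sum.atLeast_Suc_atMost)
  finally have birack: "frag_extend (cube_chain n) (birack_boundary under over (Suc n) (frag_of xs)) = ?D 0 + ?E" .
  have "gp_boundary M (Suc n) (cube_chain (Suc n) xs)
      = signed_sum (Suc n) (\<lambda>k. frag_of (tl (cell \<one>\<^bsub>G\<^esub> xs k))
          + (\<Sum>i = 1..n. frag_cmul ((-1) ^ i) (frag_of (merge i (cell \<one>\<^bsub>G\<^esub> xs k))))
          + frag_cmul ((-1) ^ Suc n) (frag_of (butlast (cell \<one>\<^bsub>G\<^esub> xs k))))"
    using n by (simp add: gp_boundary_def cube_chain_def frag_extend_signed_sum merge_def)
  also have "\<dots> = ?S tl + (\<Sum>i = 1..n. frag_cmul ((-1) ^ i) (?S (merge i)))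
      + frag_cmul ((-1) ^ Suc n) (?S butlast)"
    by (simp only: signed_sum_add signed_sum_sum signed_sum_cmul)
  also have "(\<Sum>i = 1..n. frag_cmul ((-1) ^ i) (?S (merge i))) = ?E"
    by (rule sum.cong[OF refl]) (simp add: cube_chain_merge[OF xs])
  finally have "frag_extend (cube_chain n) (birack_boundary under over (Suc n) (frag_of xs))
      - gp_boundary M (Suc n) (cube_chain (Suc n) xs)
      = ?D 0 - ?S tl - frag_cmul ((-1) ^ Suc n) (?S butlast)"
    unfolding birack by (simp add: algebra_simps)
  also have "\<dots> \<in> relations n"
    by (intro relations_diff relations_cmul cube_chain_first_face cube_chain_tl cube_chain_butlast xs n)
  finally show ?thesis .
qed

lemma cube_chain_boundary:
  assumes "Poly_Mapping.keys c \<subseteq> tuples (Suc n) X" and n: "1 \<le> n"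
  shows "frag_extend (cube_chain n) (birack_boundary under over (Suc n) c)
    - gp_boundary M (Suc n) (frag_extend (cube_chain (Suc n)) c) \<in> relations n"
  using assms(1)
proof (induction c rule: frag_induction)
  case zero
  then show ?case using n by (simp add: birack_boundary_def gp_boundary_0 relations_zero)
next
  case (one xs)
  then show ?case using cube_chain_boundary_generator[OF one n] by simp
next
  case (diff a b)
  have "birack_boundary under over (Suc n) (a - b)
      = birack_boundary under over (Suc n) a - birack_boundary under over (Suc n) b"
    using n by (simp add: birack_boundary_def frag_extend_diff)
  then show ?case
    using relations_diff[OF diff]
    by (simp only: frag_extend_diff gp_boundary_diff) (simp add: algebra_simps)
qed

lemma cube_chain_closed:
  assumes "xs \<in> tuples n X"
  shows "Poly_Mapping.keys (cube_chain n xs) \<subseteq> tuples n (carrier M)"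
proof -
  have "Poly_Mapping.keys (cube_chain n xs) \<subseteq>
      (\<Union>k\<in>exponents n. Poly_Mapping.keys (frag_cmul ((-1) ^ sum_list k) (frag_of (cell \<one>\<^bsub>G\<^esub> xs k))))"
    unfolding cube_chain_def signed_sum_def by (rule keys_sum)
  also have "\<dots> \<subseteq> tuples n (carrier M)"
  proof (intro UN_least)
    fix k assume "k \<in> exponents n"
    then have "cell \<one>\<^bsub>G\<^esub> xs k \<in> tuples n (carrier M)"
      using assms cell_closed[OF center_one, of xs k] exponents_length[of k n]
      by (simp add: tuples_def del: X_iff)
    then show "Poly_Mapping.keys (frag_cmul ((-1) ^ sum_list k) (frag_of (cell \<one>\<^bsub>G\<^esub> xs k)))
        \<subseteq> tuples n (carrier M)"
      using keys_cmul[of "(-1) ^ sum_list k" "frag_of (cell \<one>\<^bsub>G\<^esub> xs k)"] by auto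
  qed
  finally show ?thesis .
qed

lemma cube_chain_extend_closed:
  assumes "c \<in> carrier (birack_chains X n)" "1 \<le> n"
  shows "frag_extend (cube_chain n) c \<in> carrier (gp_chains M n)"
proof -
  have "Poly_Mapping.keys c \<subseteq> tuples n X" using assms by (simp add: birack_chains_def)
  then have "Poly_Mapping.keys (frag_extend (cube_chain n) c) \<subseteq> tuples n (carrier M)"
    using keys_frag_extend[of "cube_chain n" c] cube_chain_closed by blast
  then show ?thesis using assms by (simp add: gp_chains_def)
qed

lemma birack_boundary_closed:
  assumes c: "c \<in> carrier (birack_chains X (Suc n))" and n: "1 \<le> n"
  shows "birack_boundary under over (Suc n) c \<in> carrier (birack_chains X n)"
proof -
  let ?F = "\<lambda>xs. \<Sum>i<Suc n. frag_cmul ((-1) ^ i) (frag_of (face_delete i xs) - frag_of (face_act i xs))"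
  have "Poly_Mapping.keys (?F xs) \<subseteq> tuples n X" if xs: "xs \<in> tuples (Suc n) X" for xs
  proof (rule order.trans[OF keys_sum UN_least])
    fix i assume "i \<in> {..<Suc n}"
    then have "Poly_Mapping.keys (frag_of (face_delete i xs) - frag_of (face_act i xs)) \<subseteq> tuples n X"
      using faces_closed[OF xs, of i] keys_diff[of "frag_of (face_delete i xs)" "frag_of (face_act i xs)"]
      by (auto simp del: X_iff)
    then show "Poly_Mapping.keys (frag_cmul ((-1) ^ i) (frag_of (face_delete i xs) - frag_of (face_act i xs)))
        \<subseteq> tuples n X"
      using keys_cmul by blast
  qed
  moreover have "birack_boundary under over (Suc n) c = frag_extend ?F c"
    using n by (simp add: birack_boundary_def face_delete_def face_act_def)
  moreover have "Poly_Mapping.keys c \<subseteq> tuples (Suc n) X" using c by (simp add: birack_chains_def)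
  ultimately have "Poly_Mapping.keys (birack_boundary under over (Suc n) c) \<subseteq> tuples n X"
    using keys_frag_extend[of ?F c] by fastforce
  then show ?thesis using n by (simp add: birack_chains_def)
qed

section \<open>Pulling back cocycles\<close>

lemma psi_gamma_cube_chain:
  assumes "c \<in> carrier (birack_chains X n)" "1 \<le> n"
  shows "psi_map G M act \<phi> n (gamma_map M n c) = coinv_class G M act n (frag_extend (cube_chain n) c)"
proof -
  have keys: "Poly_Mapping.keys c \<subseteq> tuples n X" using assms by (simp add: birack_chains_def)
  show ?thesis
    unfolding psi_map_def gamma_map_def exponents_def[symmetric]
    unfolding frag_extend_compose[unfolded o_def]
    by (rule arg_cong[where f = "coinv_class G M act n"], rule frag_extend_eq)
      (use keys in \<open>auto simp: cube_chain_def signed_sum_def psi_gamma_cell[simplified] exponents_length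
        intro!: sum.cong simp del: X_iff\<close>)
qed

lemma coinv_class_eqI:
  assumes "a \<in> carrier (gp_chains M n)" "a - b \<in> relations n"
  shows "coinv_class G M act n a = coinv_class G M act n b"
proof -
  have "b = - (a - b) + a" by simp
  then have "b \<in> relations n #>\<^bsub>gp_chains M n\<^esub> a"
    using relations_uminus[OF assms(2)] unfolding r_coset_def gp_chains_def by force
  then show ?thesis
    unfolding coinv_class_def
    using group.repr_independence[OF group_gp_chains _ assms(1) relations_subgroup] by blast
qed

lemma coinv_class_hom: "coinv_class G M act n \<in> hom (gp_chains M n) (coinv_chains G M act n)"
proof -
  have "relations n \<lhd> gp_chains M n"
    by (rule comm_group.subgroup_imp_normal[OF comm_group_gp_chains relations_subgroup])
  from normal.r_coset_hom_Mod[OF this] show ?thesis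
    by (simp add: coinv_class_def[abs_def] coinv_chains_def)
qed

lemma cube_chain_hom:
  assumes "1 \<le> n"
  shows "frag_extend (cube_chain n) \<in> hom (birack_chains X n) (gp_chains M n)"
  using cube_chain_extend_closed[OF _ assms]
  by (intro homI) (simp_all add: birack_chains_def gp_chains_def frag_extend_add)

lemma birack_cocycle_psi_gamma:
  assumes n: "1 \<le> n" and f: "group_cocycle G M act A n f"
  shows "birack_cocycle X under over A n (f \<circ> psi_map G M act \<phi> n \<circ> gamma_map M n)"
    (is "birack_cocycle _ _ _ _ _ ?\<Phi>")
proof -
  let ?P = "\<lambda>n. frag_extend (cube_chain n)" and ?cl = "coinv_class G M act"
  have f_hom: "f \<in> hom (coinv_chains G M act n) A"
    and f_zero: "\<And>U. U \<in> carrier (coinv_chains G M act (Suc n)) \<Longrightarrow> f (coinv_boundary G M act (Suc n) U) = \<one>\<^bsub>A\<^esub>"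
    using f by (simp_all add: group_cocycle_def)
  have Phi: "?\<Phi> c = f (?cl n (?P n c))" if "c \<in> carrier (birack_chains X n)" for c
    using psi_gamma_cube_chain[OF that n] by simp
  have "f \<circ> (?cl n \<circ> ?P n) \<in> hom (birack_chains X n) A"
    by (intro hom_compose[OF _ f_hom] hom_compose[OF cube_chain_hom[OF n] coinv_class_hom])
  moreover have "c \<otimes>\<^bsub>birack_chains X n\<^esub> d \<in> carrier (birack_chains X n)"
    if "c \<in> carrier (birack_chains X n)" "d \<in> carrier (birack_chains X n)" for c d
    using that Poly_Mapping.keys_add[of c d] unfolding birack_chains_def by fastforce
  ultimately have "?\<Phi> \<in> hom (birack_chains X n) A"
    unfolding hom_def by (auto simp: Phi simp del: o_apply) (simp_all add: Pi_def)
  moreover have "?\<Phi> (birack_boundary under over (Suc n) c) = \<one>\<^bsub>A\<^esub>"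
    if c: "c \<in> carrier (birack_chains X (Suc n))" for c
  proof -
    let ?d = "birack_boundary under over (Suc n) c"
    have d: "?d \<in> carrier (birack_chains X n)" by (rule birack_boundary_closed[OF c n])
    have Pc: "?P (Suc n) c \<in> carrier (gp_chains M (Suc n))"
      by (rule cube_chain_extend_closed[OF c]) simp
    have "?cl n (?P n ?d) = ?cl n (gp_boundary M (Suc n) (?P (Suc n) c))"
      using cube_chain_boundary[OF _ n, of c] c
      by (intro coinv_class_eqI cube_chain_extend_closed[OF d n]) (simp add: birack_chains_def)
    also have "\<dots> = coinv_boundary G M act (Suc n) (?cl (Suc n) (?P (Suc n) c))"
      using coinv_boundary_class[OF G.group_axioms right_module_axioms Pc] by simp
    finally have "?\<Phi> ?d = f (coinv_boundary G M act (Suc n) (?cl (Suc n) (?P (Suc n) c)))"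
      by (simp only: Phi[OF d])
    then show ?thesis
      using f_zero hom_in_carrier[OF coinv_class_hom Pc] by simp
  qed
  ultimately show ?thesis by (simp add: birack_cocycle_def)
qed

end

theorem theorem3p4:
  fixes G :: "('g, 'b) monoid_scheme" and M :: "('m, 'c) ring_scheme"
    and act :: "'m \<Rightarrow> ('g \<Rightarrow>\<^sub>0 int) \<Rightarrow> 'm" and \<phi> :: "'g \<Rightarrow> 'g"
    and A :: "('a, 'd) monoid_scheme" and n :: nat
    and f :: "('m list \<Rightarrow>\<^sub>0 int) set \<Rightarrow> 'a"
  assumes "group G"
    and "right_module (group_ring G) M act"
    and "\<phi> \<in> hom G (G\<lparr>carrier := center G\<rparr>)"
    and "comm_group A"
    and "n \<ge> 1"
    and "group_cocycle G M act A n f"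
  shows "birack_cocycle (alex_carrier G M) (alex_under G M act \<phi>) (alex_over act \<phi>) A n
           (f \<circ> psi_map G M act \<phi> n \<circ> gamma_map M n)"
proof -
  interpret group G by fact
  interpret right_module "group_ring G" M act by fact
  interpret alexander_biquandle G M act \<phi>
    by unfold_locales fact
  show ?thesis by (rule birack_cocycle_psi_gamma[OF assms(5,6)])
qed

end
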